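(* Let $\{T(t)\mid0\le t<\infty\}$ be a strongly continuous semigroup of contraction operators of class $(\mathscr{C}_0)$ on $\mathcal{X}$ with infinitesimal generator $\mathcal{A}$, and suppose that the $T(t)$ are exponential-type multiplier operators: there is a sequence $\{a(k)\}_{k=0}^\infty$ such that $Y_k(T(t)f)=e^{a(k)t}Y_kf$ for all $k\ge0$, $t>0$, $f\in\mathcal{X}$. Suppose that $T(t)f\in\mathcal{D}(\mathcal{A})=\mathcal{D}_1(\mathcal{A})$ for all $f\in\mathcal{X}$ and $t>0$, and that there is a constant $N$ independent of $t$ and $f$ such that $$t\|\mathcal{A}T(t)f\|_{\mathcal{X}}\le N\|f\|_{\mathcal{X}}\qquad\text{for all }t>0,\ f\in\mathcal{X}.$$ Then for every positive integer $r$, $$\|\oplus^rT(t)f-f\|_{\mathcal{X}}\approx K_{\mathcal{A}^r}(f,t^r)_{\mathcal{X}}$$ for all $f\in\mathcal{X}$ and $t>0$, with equivalence constants independent of $f$ and $t$.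
   Context: Let $n\ge 2$, let $\mathbb{S}^n$ be the unit sphere of $\mathbb{R}^{n+1}$ with surface measure $d\omega$, and put $\lambda=(n-1)/2$. $\mathcal{X}$ denotes either $\mathcal{L}^q(\mathbb{S}^n)$ for some $1\le q<\infty$ (complex-valued functions, usual norm) or $\mathcal{C}(\mathbb{S}^n)$ (maximum norm). $P_k^\lambda$ is the Gegenbauer polynomial defined by $(1-2tr+r^2)^{-\lambda}=\sum_{k\ge 0}P_k^\lambda(t)r^k$, and $Y_kf(x)=\frac{\Gamma(\lambda)(k+\lambda)}{2\pi^{\lambda+1}}\int_{\mathbb{S}^n}P_k^\lambda(x\cdot y)f(y)\,d\omega(y)$ is the projection of $f$ onto spherical harmonics of degree $k$. A family $\{T(t)\mid 0\le t<\infty\}$ of bounded linear operators on $\mathcal{X}$ is a semigroup of class $(\mathscr{C}_0)$ if $T(t_1+t_2)=T(t_1)T(t_2)$ for $t_1,t_2\ge0$, $T(0)=I$, and $\|T(t)f-f\|_{\mathcal{X}}\to0$ as $t\to0+$ for every $f\in\mathcal{X}$; it consists of contractions if $\|T(t)f\|_{\mathcal{X}}\le\|f\|_{\mathcal{X}}$. Its infinitesimal generator is $\mathcal{A}f=\lim_{t\to0+}(T(t)f-f)/t$ (limit in $\mathcal{X}$), with domain $\mathcal{D}(\mathcal{A})$ the set of $f$ for which the limit exists. For a positive integer $r$, $\mathcal{D}_1(\mathcal{A}^r)$ is the set of $g\in\mathcal{X}$ for which there is $h\in\mathcal{X}$ with $(a(k))^rY_kg=Y_kh$ for $k=0,1,2,\dots$,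 and then $\mathcal{A}^rg:=h$. The $K$-functional is $K_{\mathcal{A}^r}(f,s)_{\mathcal{X}}=\inf\{\|f-g\|_{\mathcal{X}}+s\|\mathcal{A}^rg\|_{\mathcal{X}}:g\in\mathcal{D}_1(\mathcal{A}^r)\}$. The $r$-th Boolean of an operator $T$ is $\oplus^rT=I-(I-T)^r$. $a\approx b$ means $C^{-1}b\le a\le Cb$ for a constant $C>0$. *)

theory Defs
  imports "HOL-Analysis.Analysis"
begin

text \<open>
  Throughout, the ambient Euclidean space \<^typ>\<open>'a::euclidean_space\<close> plays the role of
  \<open>\<real>^(n+1)\<close>, so \<open>n = DIM('a) - 1\<close>, and functions on the unit sphere are represented by
  functions on the whole type whose values off the sphere are irrelevant.
\<close>

text \<open>
  Surface measure on the unit sphere via polar coordinates: the measure of a Borel set \<open>A\<close> is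
  \<open>DIM('a)\<close> times the volume of the cone \<open>{s *\<^sub>R y | 0 < s < 1, y \<in> A}\<close>.
  It is not normalised; its total mass is computed in \<open>emeasure_sphere_measure_total\<close>.
\<close>

definition sphere_measure :: "'a::euclidean_space measure" where
  "sphere_measure =
     scale_measure (of_nat DIM('a))
       (distr (restrict_space lborel (ball 0 1 - {0})) (restrict_space borel (sphere 0 1))
          (\<lambda>x. x /\<^sub>R norm x))"

lemma space_sphere_measure: "space sphere_measure = sphere 0 1"
  by (simp add: sphere_measure_def space_restrict_space space_scale_measure)

lemma sets_sphere_measure: "sets sphere_measure = sets (restrict_space borel (sphere 0 1))"
  by (simp add: sphere_measure_def)

lemma emeasure_sphere_measure:
  fixes A :: "'a::euclidean_space set"
  assumes "A \<in> sets borel" "A \<subseteq> sphere 0 1"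
  shows "emeasure sphere_measure A =
           of_nat DIM('a) * emeasure lborel {x. 0 < norm x \<and> norm x < 1 \<and> x /\<^sub>R norm x \<in> A}"
proof -
  let ?R = "restrict_space lborel (ball 0 1 - {0::'a})"
  have m: "(\<lambda>x. x /\<^sub>R norm x) \<in> ?R \<rightarrow>\<^sub>M restrict_space borel (sphere 0 1)"
    by (rule measurable_restrict_space2)
       (auto simp: space_restrict_space intro!: measurable_restrict_space1)
  have "A \<in> sets (restrict_space borel (sphere 0 1))"
    using assms by (auto simp: sets_restrict_space)
  moreover have "(\<lambda>x. x /\<^sub>R norm x) -` A \<inter> space ?R =
      {x. 0 < norm x \<and> norm x < 1 \<and> x /\<^sub>R norm x \<in> A}"
    by (auto simp: space_restrict_space)
  moreover have "emeasure ?R B = emeasure lborel B" if "B \<subseteq> ball 0 1 - {0}" for B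
    using that by (subst emeasure_restrict_space) auto
  ultimately show ?thesis
    using m by (simp add: sphere_measure_def emeasure_distr subset_eq)
qed

lemma emeasure_sphere_measure_total:
  "emeasure (sphere_measure :: 'a::euclidean_space measure) (sphere 0 1) =
     ennreal (2 * pi powr (DIM('a) / 2) / Gamma (DIM('a) / 2))"
proof -
  have "{x::'a. 0 < norm x \<and> norm x < 1 \<and> x /\<^sub>R norm x \<in> sphere 0 1} = ball 0 1 - {0}"
    by auto
  moreover have "emeasure lborel (ball 0 1 - {0::'a}) = emeasure lborel (ball (0::'a) 1)"
    by (subst emeasure_Diff) auto
  ultimately have "emeasure (sphere_measure :: 'a measure) (sphere 0 1) =
      of_nat DIM('a) * ennreal (unit_ball_vol DIM('a))"
    by (simp add: emeasure_sphere_measure emeasure_ball)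
  also have "\<dots> = ennreal (DIM('a) * unit_ball_vol DIM('a))"
    by (simp add: ennreal_mult ennreal_of_nat_eq_real_of_nat)
  also have "DIM('a) * unit_ball_vol DIM('a) = 2 * pi powr (DIM('a) / 2) / Gamma (DIM('a) / 2)"
  proof -
    have "Gamma (real DIM('a) / 2 + 1) = real DIM('a) / 2 * Gamma (real DIM('a) / 2)"
      by (rule Gamma_plus1) (auto dest: nonpos_Ints_nonpos)
    then show ?thesis unfolding unit_ball_vol_def by (simp only:) simp
  qed
  finally show ?thesis .
qed

text \<open>
  \<open>gegenbauer l k t\<close> is the coefficient of \<open>r^k\<close> in \<open>(1 - 2 * t * r + r^2) powr (- l)\<close>;
  note that \<^term>\<open>fps_binomial c\<close> is the power series of \<open>(1 + u) powr c\<close> in \<open>u\<close>.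
\<close>

definition gegenbauer :: "real \<Rightarrow> nat \<Rightarrow> real \<Rightarrow> real" where
  "gegenbauer l k t =
     fps_nth (fps_binomial (- l) oo (fps_X ^ 2 - fps_const (2 * t) * fps_X)) k"

definition harmonic_proj ::
    "nat \<Rightarrow> ('a::euclidean_space \<Rightarrow> complex) \<Rightarrow> 'a \<Rightarrow> complex" where
  "harmonic_proj k f x =
     (let l = (real DIM('a) - 2) / 2 in
      complex_of_real (Gamma l * (real k + l) / (2 * pi powr (l + 1))) *
      (\<integral>y. complex_of_real (gegenbauer l k (x \<bullet> y)) * f y \<partial>sphere_measure))"

text \<open>
  \<open>Lq q\<close> stands for the Lebesgue space with exponent \<open>q\<close> on the sphere and \<open>Cont\<close> for the
  continuous functions. Elements of these spaces are represented by functions;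
  two representatives denote the same element iff they are related by \<open>sp_eq\<close>, and
  every identity between elements is stated in terms of \<open>sp_eq\<close>.
\<close>

datatype sphere_space = Lq real | Cont

fun valid_space :: "sphere_space \<Rightarrow> bool" where
  "valid_space (Lq q) \<longleftrightarrow> 1 \<le> q"
| "valid_space Cont \<longleftrightarrow> True"

fun sp_carrier :: "sphere_space \<Rightarrow> ('a::euclidean_space \<Rightarrow> complex) set" where
  "sp_carrier (Lq q) = {f \<in> borel_measurable sphere_measure.
                          integrable sphere_measure (\<lambda>x. norm (f x) powr q)}"
| "sp_carrier Cont = {f. continuous_on (sphere 0 1) f}"

fun sp_norm :: "sphere_space \<Rightarrow> ('a::euclidean_space \<Rightarrow> complex) \<Rightarrow> real" where
  "sp_norm (Lq q) f = (\<integral>x. norm (f x) powr q \<partial>sphere_measure) powr (1 / q)"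
| "sp_norm Cont f = (SUP x\<in>sphere 0 1. norm (f x))"

fun sp_eq :: "sphere_space \<Rightarrow> ('a::euclidean_space \<Rightarrow> complex) \<Rightarrow> ('a \<Rightarrow> complex) \<Rightarrow> bool" where
  "sp_eq (Lq q) f g \<longleftrightarrow> (AE x in sphere_measure. f x = g x)"
| "sp_eq Cont f g \<longleftrightarrow> (\<forall>x\<in>sphere 0 1. f x = g x)"

text \<open>
  Compatibility of the operators with \<open>sp_eq\<close> need not be required separately: it follows from
  linearity and boundedness.
\<close>

definition bounded_operator ::
    "sphere_space \<Rightarrow> (('a::euclidean_space \<Rightarrow> complex) \<Rightarrow> ('a \<Rightarrow> complex)) \<Rightarrow> bool" where
  "bounded_operator X U \<longleftrightarrow>
     (\<forall>f\<in>sp_carrier X. U f \<in> sp_carrier X) \<and>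
     (\<forall>f\<in>sp_carrier X. \<forall>g\<in>sp_carrier X. \<forall>c d.
        sp_eq X (U (\<lambda>x. c * f x + d * g x)) (\<lambda>x. c * U f x + d * U g x)) \<and>
     (\<exists>B. \<forall>f\<in>sp_carrier X. sp_norm X (U f) \<le> B * sp_norm X f)"

definition C0_semigroup ::
    "sphere_space \<Rightarrow> (real \<Rightarrow> ('a::euclidean_space \<Rightarrow> complex) \<Rightarrow> ('a \<Rightarrow> complex)) \<Rightarrow> bool" where
  "C0_semigroup X T \<longleftrightarrow>
     (\<forall>t\<ge>0. bounded_operator X (T t)) \<and>
     (\<forall>s\<ge>0. \<forall>t\<ge>0. \<forall>f\<in>sp_carrier X. sp_eq X (T (s + t) f) (T s (T t f))) \<and>
     (\<forall>f\<in>sp_carrier X. sp_eq X (T 0 f) f) \<and>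
     (\<forall>f\<in>sp_carrier X. ((\<lambda>t. sp_norm X (T t f - f)) \<longlongrightarrow> 0) (at_right 0))"

definition contractive ::
    "sphere_space \<Rightarrow> (real \<Rightarrow> ('a::euclidean_space \<Rightarrow> complex) \<Rightarrow> ('a \<Rightarrow> complex)) \<Rightarrow> bool" where
  "contractive X T \<longleftrightarrow> (\<forall>t\<ge>0. \<forall>f\<in>sp_carrier X. sp_norm X (T t f) \<le> sp_norm X f)"

definition is_generator_value ::
    "sphere_space \<Rightarrow> (real \<Rightarrow> ('a::euclidean_space \<Rightarrow> complex) \<Rightarrow> ('a \<Rightarrow> complex)) \<Rightarrow>
     ('a \<Rightarrow> complex) \<Rightarrow> ('a \<Rightarrow> complex) \<Rightarrow> bool" where
  "is_generator_value X T f h \<longleftrightarrow> h \<in> sp_carrier X \<and>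
     ((\<lambda>t. sp_norm X (\<lambda>x. (T t f x - f x) / complex_of_real t - h x)) \<longlongrightarrow> 0) (at_right 0)"

definition generator_domain ::
    "sphere_space \<Rightarrow> (real \<Rightarrow> ('a::euclidean_space \<Rightarrow> complex) \<Rightarrow> ('a \<Rightarrow> complex)) \<Rightarrow>
     ('a \<Rightarrow> complex) set" where
  "generator_domain X T = {f \<in> sp_carrier X. \<exists>h. is_generator_value X T f h}"

text \<open>The limit is unique up to \<open>sp_eq\<close>, so the choice of representative is immaterial.\<close>

definition generator ::
    "sphere_space \<Rightarrow> (real \<Rightarrow> ('a::euclidean_space \<Rightarrow> complex) \<Rightarrow> ('a \<Rightarrow> complex)) \<Rightarrow>
     ('a \<Rightarrow> complex) \<Rightarrow> ('a \<Rightarrow> complex)" where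
  "generator X T f = (SOME h. is_generator_value X T f h)"

definition exponential_multiplier ::
    "sphere_space \<Rightarrow> (nat \<Rightarrow> complex) \<Rightarrow>
     (real \<Rightarrow> ('a::euclidean_space \<Rightarrow> complex) \<Rightarrow> ('a \<Rightarrow> complex)) \<Rightarrow> bool" where
  "exponential_multiplier X a T \<longleftrightarrow>
     (\<forall>k. \<forall>t>0. \<forall>f\<in>sp_carrier X. \<forall>x\<in>sphere 0 1.
        harmonic_proj k (T t f) x = exp (a k * complex_of_real t) * harmonic_proj k f x)"

definition is_multiplier_power_value ::
    "sphere_space \<Rightarrow> (nat \<Rightarrow> complex) \<Rightarrow> nat \<Rightarrow> ('a::euclidean_space \<Rightarrow> complex) \<Rightarrow>
     ('a \<Rightarrow> complex) \<Rightarrow> bool" where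
  "is_multiplier_power_value X a r g h \<longleftrightarrow> h \<in> sp_carrier X \<and>
     (\<forall>k. \<forall>x\<in>sphere 0 1. a k ^ r * harmonic_proj k g x = harmonic_proj k h x)"

definition multiplier_power_domain ::
    "sphere_space \<Rightarrow> (nat \<Rightarrow> complex) \<Rightarrow> nat \<Rightarrow> ('a::euclidean_space \<Rightarrow> complex) set" where
  "multiplier_power_domain X a r =
     {g \<in> sp_carrier X. \<exists>h. is_multiplier_power_value X a r g h}"

text \<open>
  An element is determined by its projections, so again the choice of representative is
  immaterial.
\<close>

definition multiplier_power ::
    "sphere_space \<Rightarrow> (nat \<Rightarrow> complex) \<Rightarrow> nat \<Rightarrow> ('a::euclidean_space \<Rightarrow> complex) \<Rightarrow>
     ('a \<Rightarrow> complex)" where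
  "multiplier_power X a r g = (SOME h. is_multiplier_power_value X a r g h)"

definition K_functional ::
    "sphere_space \<Rightarrow> (nat \<Rightarrow> complex) \<Rightarrow> nat \<Rightarrow> ('a::euclidean_space \<Rightarrow> complex) \<Rightarrow> real \<Rightarrow> real"
  where
  "K_functional X a r f s =
     (INF g\<in>multiplier_power_domain X a r.
        sp_norm X (f - g) + s * sp_norm X (multiplier_power X a r g))"

definition boolean_sum ::
    "nat \<Rightarrow> (('a \<Rightarrow> complex) \<Rightarrow> ('a \<Rightarrow> complex)) \<Rightarrow> ('a \<Rightarrow> complex) \<Rightarrow> ('a \<Rightarrow> complex)" where
  "boolean_sum r U f = f - ((\<lambda>g. g - U g) ^^ r) f"

end

theory Submission
  imports Defs "HOL-Library.Function_Algebras"
begin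

text \<open>
  The theorem is a statement about commuting multiplication operators. Sending \<open>f\<close> to its family of
  projections \<open>(Y_k f)(x)\<close> turns \<open>T(t)\<close> into multiplication by \<open>exp (a(k) t)\<close> and
  \<open>\<A>\<^sup>r\<close> into multiplication by \<open>a(k)\<^sup>r\<close>. An element of the space is determined by
  its projections (\<open>harmonic_coeffs_injective\<close>), so the norm can be carried over to the range of
  this map, and every identity between operators becomes an identity in a commutative ring. What the
  hypotheses say about this picture is collected in the locale
  \<open>smoothing_multiplier_semigroup\<close>; there \<open>e t\<close> is the multiplier of \<open>T(t)\<close> and
  \<open>\<oplus>\<^sup>rT(t)f - f\<close> is, up to sign, \<open>(1 - e t)\<^sup>r \<phi>\<close>.

  The bound of \<open>\<parallel>(1 - e t)\<^sup>r \<phi>\<parallel>\<close> by the \<open>K\<close>-functional (\<open>direct_estimate\<close>) holds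
  because one increment of a contraction semigroup costs at most
  \<open>\<parallel>(1 - e t) \<psi>\<parallel> \<le> t \<parallel>a \<psi>\<parallel>\<close>; iterating gives \<open>t\<^sup>r \<parallel>a\<^sup>r \<psi>\<parallel>\<close>, and
  \<open>\<phi> - \<psi>\<close> costs at most the factor \<open>2\<^sup>r\<close>.

  For the converse (\<open>converse_estimate\<close>) the element \<open>\<psi> = \<phi> - (1 - e (m t))\<^sup>r \<phi>\<close> is inserted
  into the \<open>K\<close>-functional. Its distance to \<open>\<phi>\<close> is at most \<open>m\<^sup>r \<parallel>(1 - e t)\<^sup>r \<phi>\<parallel>\<close>, so it
  remains to bound \<open>t\<^sup>r \<parallel>a\<^sup>r e(m t) \<phi>\<parallel>\<close> by \<open>\<parallel>(1 - e t)\<^sup>r \<phi>\<parallel>\<close>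
  (\<open>generator_power_le_boolean_power\<close>). By a Taylor expansion, \<open>(t a)\<^sup>r\<close> and
  \<open>(e t - 1)\<^sup>r\<close> differ on \<open>e(m t) \<phi>\<close> by at most
  \<open>r t\<^bsup>r+1\<^esup> \<parallel>a\<^bsup>r+1\<^esup> e(m t) \<phi>\<parallel>\<close>. Spending all the time but \<open>t\<close> on one factor \<open>a\<close>, the
  smoothing hypothesis bounds this remainder by \<open>1 / (m - 1)\<close> times a constant times
  \<open>t\<^sup>r \<parallel>a\<^sup>r e(t) \<phi>\<parallel>\<close>, and the latter is controlled by the quantity that is to be estimated, plus
  a multiple of \<open>\<parallel>(1 - e t)\<^sup>r \<phi>\<parallel>\<close>. For \<open>m\<close> large the remainder is therefore absorbed.

  Injectivity is the completeness of the spherical harmonics (\<open>harmonic_proj_complete\<close>). The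
  Gegenbauer polynomial of degree \<open>k\<close> has exact degree \<open>k\<close>, so a function whose projections
  all vanish is orthogonal to all powers \<open>(x \<bullet> y)\<^sup>m\<close>, hence to all exponentials
  \<open>exp (z \<bullet> y)\<close>. These span a separating algebra of functions, and the Stone--Weierstrass theorem
  finishes the argument.
\<close>

section \<open>Smoothing semigroups of commuting multipliers\<close>

lemma filterlim_divide_Suc_at_right:
  assumes "(0::real) < t"
  shows "filterlim (\<lambda>n. t / real (Suc n)) (at_right 0) sequentially"
  using assms LIMSEQ_Suc[OF lim_const_over_n[of t]]
  by (auto simp: filterlim_at simp del: of_nat_Suc)

text \<open>
  \<open>'r\<close> is a ring of multipliers which also contains the space \<open>V\<close> on which they act, like a
  ring of functions under pointwise multiplication; an operator is multiplication by a ring element,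
  so all operators commute for free. \<open>cst c\<close> is the scalar \<open>c\<close>, \<open>e t\<close> the multiplier of
  the semigroup and \<open>a\<close> that of its generator. In general \<open>a\<close> does not map \<open>V\<close> into
  \<open>V\<close>; the last assumption says that wherever it does, it is the strong derivative of \<open>e\<close>
  at \<open>0\<close>.
\<close>

locale smoothing_multiplier_semigroup =
  fixes V :: "'r::comm_ring_1 set" and \<nu> :: "'r \<Rightarrow> real"
    and cst :: "real \<Rightarrow> 'r" and e :: "real \<Rightarrow> 'r" and a :: 'r and N :: real
  assumes cst_add: "cst (c + d) = cst c + cst d"
    and cst_mult: "cst (c * d) = cst c * cst d"
    and cst_1 [simp]: "cst 1 = 1"
    and e_add: "e (s + t) = e s * e t"
    and e_0: "e 0 = 1"
    and V_add: "\<phi> \<in> V \<Longrightarrow> \<psi> \<in> V \<Longrightarrow> \<phi> + \<psi> \<in> V"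
    and V_scale: "\<phi> \<in> V \<Longrightarrow> cst c * \<phi> \<in> V"
    and nu_triangle: "\<phi> \<in> V \<Longrightarrow> \<psi> \<in> V \<Longrightarrow> \<nu> (\<phi> + \<psi>) \<le> \<nu> \<phi> + \<nu> \<psi>"
    and nu_scale: "\<phi> \<in> V \<Longrightarrow> \<nu> (cst c * \<phi>) = \<bar>c\<bar> * \<nu> \<phi>"
    and e_V: "0 < t \<Longrightarrow> \<phi> \<in> V \<Longrightarrow> e t * \<phi> \<in> V"
    and e_contractive: "0 < t \<Longrightarrow> \<phi> \<in> V \<Longrightarrow> \<nu> (e t * \<phi>) \<le> \<nu> \<phi>"
    and e_continuous: "\<phi> \<in> V \<Longrightarrow> ((\<lambda>t. \<nu> (e t * \<phi> - \<phi>)) \<longlongrightarrow> 0) (at_right 0)"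
    and e_smoothing: "0 < t \<Longrightarrow> \<phi> \<in> V \<Longrightarrow> a * e t * \<phi> \<in> V"
    and e_smoothing_bound: "0 < t \<Longrightarrow> \<phi> \<in> V \<Longrightarrow> t * \<nu> (a * e t * \<phi>) \<le> N * \<nu> \<phi>"
    and e_derivative: "\<phi> \<in> V \<Longrightarrow> a * \<phi> \<in> V \<Longrightarrow>
      ((\<lambda>t. \<nu> (cst (1 / t) * (e t * \<phi> - \<phi>) - a * \<phi>)) \<longlongrightarrow> 0) (at_right 0)"
begin

lemma cst_0 [simp]: "cst 0 = 0"
  using cst_add[of 0 0] by simp

lemma cst_uminus: "cst (- c) = - cst c"
  using cst_add[of c "- c"] by (simp add: eq_neg_iff_add_eq_0 add.commute)

lemma cst_power: "cst (c ^ j) = cst c ^ j"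
  by (induction j) (simp_all add: cst_mult)

lemma V_minus: "\<phi> \<in> V \<Longrightarrow> - \<phi> \<in> V"
  and nu_minus: "\<phi> \<in> V \<Longrightarrow> \<nu> (- \<phi>) = \<nu> \<phi>"
proof -
  have *: "- \<phi> = cst (-1) * \<phi>" by (simp add: cst_uminus)
  show "\<phi> \<in> V \<Longrightarrow> - \<phi> \<in> V" "\<phi> \<in> V \<Longrightarrow> \<nu> (- \<phi>) = \<nu> \<phi>"
    unfolding * by (simp_all add: V_scale nu_scale)
qed

lemma V_diff: "\<phi> \<in> V \<Longrightarrow> \<psi> \<in> V \<Longrightarrow> \<phi> - \<psi> \<in> V"
  using V_add[of \<phi> "- \<psi>"] V_minus by simp

lemma nu_diff: "\<phi> \<in> V \<Longrightarrow> \<psi> \<in> V \<Longrightarrow> \<nu> (\<phi> - \<psi>) \<le> \<nu> \<phi> + \<nu> \<psi>"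
  using nu_triangle[of \<phi> "- \<psi>"] V_minus nu_minus by simp

lemma nu_triangle_diff: "\<phi> \<in> V \<Longrightarrow> \<psi> \<in> V \<Longrightarrow> \<nu> \<phi> \<le> \<nu> \<psi> + \<nu> (\<phi> - \<psi>)"
  using nu_triangle[of \<psi> "\<phi> - \<psi>"] V_diff by simp

lemma nu_nonneg: "\<phi> \<in> V \<Longrightarrow> 0 \<le> \<nu> \<phi>"
  using nu_diff[of \<phi> \<phi>] nu_scale[of \<phi> 0] by simp

lemma nu_rescale: "0 < s \<Longrightarrow> \<phi> \<in> V \<Longrightarrow> s * \<nu> (cst (1 / s) * \<phi>) = \<nu> \<phi>"
  by (simp add: nu_scale)

lemma boolean_V: "0 < t \<Longrightarrow> \<phi> \<in> V \<Longrightarrow> (1 - e t) ^ j * \<phi> \<in> V"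
  and boolean_bound: "0 < t \<Longrightarrow> \<phi> \<in> V \<Longrightarrow> \<nu> ((1 - e t) ^ j * \<phi>) \<le> 2 ^ j * \<nu> \<phi>"
proof (induction j)
  case 0
  {
    case 1 then show ?case by simp
  next
    case 2 then show ?case by simp
  }
next
  case (Suc j)
  let ?\<psi> = "(1 - e t) ^ j * \<phi>"
  have eq: "(1 - e t) ^ Suc j * \<phi> = ?\<psi> - e t * ?\<psi>" by (simp add: algebra_simps)
  {
    case 1 then show ?case unfolding eq using Suc by (intro V_diff e_V) auto
  next
    case 2
    have "\<nu> (?\<psi> - e t * ?\<psi>) \<le> \<nu> ?\<psi> + \<nu> (e t * ?\<psi>)"
      using Suc 2 by (intro nu_diff e_V) auto
    also have "\<dots> \<le> \<nu> ?\<psi> + \<nu> ?\<psi>"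
      using Suc 2 e_contractive by auto
    also have "\<dots> \<le> 2 ^ Suc j * \<nu> \<phi>" using Suc 2 by auto
    finally show ?case unfolding eq .
  }
qed

text \<open>
  Telescoping: \<open>1 - e (p t)\<close> is \<open>1 - e t\<close> times a sum of \<open>p\<close> contractions.
\<close>

lemma increment_multiple:
  assumes "0 < t" "\<phi> \<in> V"
  shows "\<nu> ((1 - e (real p * t)) * \<phi>) \<le> real p * \<nu> ((1 - e t) * \<phi>)"
proof (induction p)
  case 0
  show ?case using nu_scale[OF assms(2), of 0] by (simp add: e_0)
next
  case (Suc p)
  show ?case
  proof (cases "p = 0")
    case False
    have eq: "(1 - e (real (Suc p) * t)) * \<phi> =
        (1 - e (real p * t)) * \<phi> + e (real p * t) * ((1 - e t) * \<phi>)"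
      using e_add[of "real p * t" t] by (simp add: algebra_simps)
    have V: "(1 - e s) * \<phi> \<in> V" if "0 < s" for s
      using boolean_V[OF that assms(2), of 1] by simp
    have "\<nu> ((1 - e (real (Suc p) * t)) * \<phi>) \<le>
        \<nu> ((1 - e (real p * t)) * \<phi>) + \<nu> (e (real p * t) * ((1 - e t) * \<phi>))"
      unfolding eq using False assms V by (intro nu_triangle e_V) auto
    also have "\<nu> (e (real p * t) * ((1 - e t) * \<phi>)) \<le> \<nu> ((1 - e t) * \<phi>)"
      using False assms V by (intro e_contractive) auto
    finally show ?thesis using Suc by (simp add: algebra_simps)
  qed simp
qed

lemma increment_multiple_power:
  assumes "0 < t" "\<phi> \<in> V" "0 < p"
  shows "\<nu> ((1 - e (real p * t)) ^ j * \<phi>) \<le> real p ^ j * \<nu> ((1 - e t) ^ j * \<phi>)"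
  using assms(2)
proof (induction j arbitrary: \<phi>)
  case (Suc j)
  have pt: "0 < real p * t" using assms by simp
  have 1: "(1 - e (real p * t)) * \<phi> \<in> V" "(1 - e t) ^ j * \<phi> \<in> V"
    using boolean_V[OF pt Suc(2), of 1] boolean_V[OF assms(1) Suc(2)] by simp_all
  have "\<nu> ((1 - e (real p * t)) ^ Suc j * \<phi>) \<le>
      real p ^ j * \<nu> ((1 - e t) ^ j * ((1 - e (real p * t)) * \<phi>))"
    using Suc(1)[OF 1(1)] by (simp add: mult_ac)
  also have "(1 - e t) ^ j * ((1 - e (real p * t)) * \<phi>) = (1 - e (real p * t)) * ((1 - e t) ^ j * \<phi>)"
    by (simp add: mult_ac)
  also have "real p ^ j * \<nu> \<dots> \<le> real p ^ j * (real p * \<nu> ((1 - e t) * ((1 - e t) ^ j * \<phi>)))"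
    by (intro mult_left_mono increment_multiple assms 1) auto
  finally show ?case by (simp add: mult_ac)
qed simp

text \<open>
  The classical proof integrates \<open>e s * a * \<phi>\<close> over \<open>[0, t]\<close>. Instead of a vector-valued
  integral, \<open>[0, t]\<close> is cut into \<open>n\<close> equal pieces: each contributes at most
  \<open>\<nu> ((1 - e (t / n)) * \<phi>)\<close>, and \<open>n / t\<close> times this tends to \<open>\<nu> (a * \<phi>)\<close>.
\<close>

lemma first_order_bound:
  assumes "0 < t" "\<phi> \<in> V" "a * \<phi> \<in> V"
  shows "\<nu> ((1 - e t) * \<phi>) \<le> t * \<nu> (a * \<phi>)"
proof -
  let ?D = "\<lambda>s. \<nu> (cst (1 / s) * (e s * \<phi> - \<phi>) - a * \<phi>)"
  have lim: "(\<lambda>n. t * (\<nu> (a * \<phi>) + ?D (t / real (Suc n)))) \<longlonglongrightarrow> t * (\<nu> (a * \<phi>) + 0)"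
    by (intro tendsto_intros filterlim_compose[OF e_derivative[OF assms(2,3)]]
        filterlim_divide_Suc_at_right assms(1))
  have "\<nu> ((1 - e t) * \<phi>) \<le> t * (\<nu> (a * \<phi>) + 0)"
  proof (rule LIMSEQ_le_const[OF lim], intro exI allI impI)
    fix n :: nat
    let ?s = "t / real (Suc n)"
    have s: "0 < ?s" using assms by simp
    have D: "(1 - e ?s) * \<phi> \<in> V" "e ?s * \<phi> - \<phi> \<in> V"
      using boolean_V[OF s assms(2), of 1] s assms by (auto intro!: V_diff e_V)
    have "\<nu> ((1 - e t) * \<phi>) \<le> real (Suc n) * \<nu> ((1 - e ?s) * \<phi>)"
      using increment_multiple[OF s assms(2), of "Suc n"] by (simp del: of_nat_Suc)
    also have "(1 - e ?s) * \<phi> = - (e ?s * \<phi> - \<phi>)" by (simp add: algebra_simps)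
    also have "\<nu> \<dots> = ?s * \<nu> (cst (1 / ?s) * (e ?s * \<phi> - \<phi>))"
      using nu_rescale[OF s D(2)] D(2) by (simp only: nu_minus)
    also have "real (Suc n) * (?s * \<nu> (cst (1 / ?s) * (e ?s * \<phi> - \<phi>))) =
        t * \<nu> (cst (1 / ?s) * (e ?s * \<phi> - \<phi>))" by (simp del: of_nat_Suc)
    also have "\<dots> \<le> t * (\<nu> (a * \<phi>) + ?D ?s)"
      using D(2) assms by (intro mult_left_mono nu_triangle_diff V_scale) auto
    finally show "\<nu> ((1 - e t) * \<phi>) \<le> t * (\<nu> (a * \<phi>) + ?D ?s)" .
  qed
  then show ?thesis by simp
qed

text \<open>
  The first-order Taylor remainder, again by subdivision: passing from \<open>u\<close> to \<open>u + s\<close>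
  adds to the remainder \<open>e u\<close> times the remainder at \<open>s\<close>, which is \<open>o(s)\<close>, and
  \<open>s\<close> times an increment of \<open>a * \<phi>\<close>, which is bounded by \<open>first_order_bound\<close>. The factor
  \<open>1 / 2\<close> of Taylor's formula is given away.
\<close>

lemma second_order_bound:
  assumes "0 < t" "\<phi> \<in> V" "a * \<phi> \<in> V" "a * (a * \<phi>) \<in> V"
  shows "\<nu> ((e t - 1 - cst t * a) * \<phi>) \<le> t\<^sup>2 * \<nu> (a * (a * \<phi>))"
proof -
  let ?R = "\<lambda>s. (e s - 1 - cst s * a) * \<phi>"
  let ?M = "\<nu> (a * (a * \<phi>))"
  have R_V: "?R s \<in> V" if "0 < s" for s
  proof -
    have "?R s = e s * \<phi> - \<phi> - cst s * (a * \<phi>)" by (simp add: algebra_simps)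
    then show ?thesis using that assms by (auto intro!: V_diff e_V V_scale)
  qed
  have step: "\<nu> (?R (real (Suc n) * s)) \<le> real (Suc n) * \<nu> (?R s) + (real (Suc n) * s)\<^sup>2 * ?M"
    if s: "0 < s" for s n
  proof (induction n)
    case 0
    then show ?case using nu_nonneg[OF assms(4)] by simp
  next
    case (Suc n)
    let ?u = "real (Suc n) * s"
    have u: "0 < ?u" using s by simp
    have split: "?R (u + s) = e u * ?R s + ?R u - cst s * ((1 - e u) * (a * \<phi>))" for u
      by (simp add: e_add cst_add algebra_simps)
    have V: "(1 - e ?u) * (a * \<phi>) \<in> V" using boolean_V[OF u assms(3), of 1] by simp
    have "\<nu> (?R (?u + s)) \<le> \<nu> (e ?u * ?R s + ?R ?u) + \<nu> (cst s * ((1 - e ?u) * (a * \<phi>)))"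
      unfolding split using s u V by (intro nu_diff V_add e_V R_V V_scale)
    also have "\<dots> \<le> (\<nu> (e ?u * ?R s) + \<nu> (?R ?u)) + s * \<nu> ((1 - e ?u) * (a * \<phi>))"
      using s u V by (intro add_mono nu_triangle e_V R_V) (auto simp: nu_scale)
    also have "\<dots> \<le> (\<nu> (?R s) + (real (Suc n) * \<nu> (?R s) + ?u\<^sup>2 * ?M)) + s * (?u * ?M)"
      using s u assms Suc by (intro add_mono e_contractive mult_left_mono first_order_bound R_V) auto
    also have "\<dots> = real (Suc (Suc n)) * \<nu> (?R s) + (?u\<^sup>2 + s * ?u) * ?M"
      by (simp add: algebra_simps)
    also have "\<dots> \<le> real (Suc (Suc n)) * \<nu> (?R s) + (?u + s)\<^sup>2 * ?M"
      using nu_nonneg[OF assms(4)] s u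
      by (intro add_left_mono mult_right_mono) (simp_all add: power2_eq_square algebra_simps)
    also have "?u + s = real (Suc (Suc n)) * s" by (simp add: algebra_simps)
    finally show ?case .
  qed
  let ?D = "\<lambda>s. \<nu> (cst (1 / s) * (e s * \<phi> - \<phi>) - a * \<phi>)"
  have lim: "(\<lambda>n. t * ?D (t / real (Suc n)) + t\<^sup>2 * ?M) \<longlonglongrightarrow> t * 0 + t\<^sup>2 * ?M"
    by (intro tendsto_intros filterlim_compose[OF e_derivative[OF assms(2,3)]]
        filterlim_divide_Suc_at_right assms(1))
  have "\<nu> (?R t) \<le> t * 0 + t\<^sup>2 * ?M"
  proof (rule LIMSEQ_le_const[OF lim], intro exI allI impI)
    fix n :: nat
    let ?s = "t / real (Suc n)"
    have s: "0 < ?s" using assms by simp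
    have "\<nu> (?R t) \<le> real (Suc n) * \<nu> (?R ?s) + t\<^sup>2 * ?M"
      using step[OF s, of n] by (simp del: of_nat_Suc)
    also have "?R ?s = cst ?s * (cst (1 / ?s) * (e ?s * \<phi> - \<phi>) - a * \<phi>)"
    proof -
      have "cst ?s * cst (1 / ?s) = 1" using assms(1) by (simp add: cst_mult[symmetric])
      then have "cst ?s * (cst (1 / ?s) * \<psi>) = \<psi>" for \<psi>
        by (simp only: mult.assoc[symmetric]) simp
      then show ?thesis by (simp only: right_diff_distrib left_diff_distrib mult_1 mult.assoc)
    qed
    also have "\<nu> \<dots> = ?s * ?D ?s"
      using s assms by (subst nu_scale) (auto intro!: V_diff V_scale e_V)
    finally show "\<nu> (?R t) \<le> t * ?D ?s + t\<^sup>2 * ?M" by (simp del: of_nat_Suc)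
  qed
  then show ?thesis by simp
qed

lemma increment_power_bound:
  assumes "0 < t" "\<And>i. i \<le> j \<Longrightarrow> a ^ i * \<phi> \<in> V"
  shows "\<nu> ((1 - e t) ^ j * \<phi>) \<le> t ^ j * \<nu> (a ^ j * \<phi>)"
  using assms(2)
proof (induction j arbitrary: \<phi>)
  case (Suc j)
  have V: "a ^ i * ((1 - e t) * \<phi>) \<in> V" if "i \<le> j" for i
    using boolean_V[OF assms(1) Suc(2)[of i], of 1] that by (simp add: mult_ac)
  have "\<nu> ((1 - e t) ^ Suc j * \<phi>) \<le> t ^ j * \<nu> (a ^ j * ((1 - e t) * \<phi>))"
    using Suc(1)[OF V] by (simp add: mult_ac)
  also have "a ^ j * ((1 - e t) * \<phi>) = (1 - e t) * (a ^ j * \<phi>)" by (simp add: mult_ac)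
  also have "t ^ j * \<nu> \<dots> \<le> t ^ j * (t * \<nu> (a * (a ^ j * \<phi>)))"
    using Suc(2)[of j] Suc(2)[of "Suc j"] assms(1)
    by (intro mult_left_mono first_order_bound) (auto simp: mult_ac)
  finally show ?case by (simp add: mult_ac)
qed simp

text \<open>
  With \<open>B = e t - 1\<close> and \<open>A = t a\<close>, write \<open>B\<^sup>j - A\<^sup>j\<close> as a telescoping sum of
  \<open>j\<close> terms \<open>B\<^sup>i (B - A) A\<^bsup>j-1-i\<^esup>\<close>. By \<open>first_order_bound\<close> and \<open>second_order_bound\<close> every term costs one power
  of \<open>t a\<close> more than it has factors.
\<close>

lemma increment_power_remainder:
  assumes "0 < t" "\<And>i. i \<le> Suc j \<Longrightarrow> a ^ i * \<phi> \<in> V"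
  shows "\<nu> (((e t - 1) ^ j - (cst t * a) ^ j) * \<phi>) \<le> real j * t ^ Suc j * \<nu> (a ^ Suc j * \<phi>)
    \<and> ((e t - 1) ^ j - (cst t * a) ^ j) * \<phi> \<in> V"
  using assms(2)
proof (induction j arbitrary: \<phi>)
  case 0
  then show ?case using nu_scale[of \<phi> 0] V_scale[of \<phi> 0]  0[of 0]
    by simp
next
  case (Suc j)
  let ?\<psi> = "(1 - e t) * \<phi>"
  have \<psi>: "a ^ i * ?\<psi> \<in> V" if "i \<le> Suc j" for i
    using boolean_V[OF assms(1) Suc(2)[of i], of 1] that by (simp add: mult_ac)
  let ?A = "((e t - 1) ^ j - (cst t * a) ^ j) * ?\<psi>"
  let ?B = "(e t - 1 - cst t * a) * (a ^ j * \<phi>)"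
  have eq: "((e t - 1) ^ Suc j - (cst t * a) ^ Suc j) * \<phi> = cst (t ^ j) * ?B - ?A"
    by (simp add: algebra_simps power_mult_distrib cst_power)
  have V: "a ^ j * \<phi> \<in> V" "a * (a ^ j * \<phi>) \<in> V" "a * (a * (a ^ j * \<phi>)) \<in> V"
    using Suc(2)[of j] Suc(2)[of "Suc j"] Suc(2)[of "Suc (Suc j)"] by (simp_all add: mult_ac)
  have B: "?B \<in> V"
  proof -
    have "?B = e t * (a ^ j * \<phi>) - a ^ j * \<phi> - cst t * (a * (a ^ j * \<phi>))"
      by (simp add: algebra_simps)
    then show ?thesis using V assms(1) by (auto intro!: V_diff e_V V_scale)
  qed
  have "\<nu> (cst (t ^ j) * ?B - ?A) \<le> \<nu> (cst (t ^ j) * ?B) + \<nu> ?A"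
    using B Suc(1)[OF \<psi>] by (intro nu_diff V_scale) auto
  also have "\<nu> (cst (t ^ j) * ?B) = t ^ j * \<nu> ?B" using B assms(1) by (simp add: nu_scale)
  also have "\<dots> \<le> t ^ j * (t\<^sup>2 * \<nu> (a * (a * (a ^ j * \<phi>))))"
    using assms(1) V by (intro mult_left_mono second_order_bound) auto
  also have "\<nu> ?A \<le> real j * t ^ Suc j * \<nu> (a ^ Suc j * ?\<psi>)" using Suc(1)[OF \<psi>] by blast
  also have "a ^ Suc j * ?\<psi> = (1 - e t) * (a * (a ^ j * \<phi>))" by (simp add: mult_ac)
  also have "real j * t ^ Suc j * \<nu> \<dots> \<le> real j * t ^ Suc j * (t * \<nu> (a * (a * (a ^ j * \<phi>))))"
    using assms(1) V by (intro mult_left_mono first_order_bound) auto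
  finally have "\<nu> (cst (t ^ j) * ?B - ?A) \<le> real (Suc j) * t ^ Suc (Suc j) * \<nu> (a ^ Suc (Suc j) * \<phi>)"
    by (simp add: algebra_simps power2_eq_square)
  moreover have "cst (t ^ j) * ?B - ?A \<in> V"
    using B Suc(1)[OF \<psi>] by (intro V_diff V_scale) auto
  ultimately show ?case unfolding eq by blast
qed

text \<open>
  The semigroup property allots half of the time \<open>t\<close> to the last factor \<open>a\<close> and the other
  half to the remaining \<open>j\<close> factors.
\<close>

lemma smoothing_power:
  "\<exists>C\<ge>0. \<forall>t>0. \<forall>\<phi>\<in>V. a ^ j * e t * \<phi> \<in> V \<and> t ^ j * \<nu> (a ^ j * e t * \<phi>) \<le> C * \<nu> \<phi>"
proof (induction j)
  case 0
  show ?case using e_V e_contractive by (intro exI[of _ 1]) auto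
next
  case (Suc j)
  then obtain C where C: "0 \<le> C" "\<And>t \<phi>. 0 < t \<Longrightarrow> \<phi> \<in> V \<Longrightarrow> a ^ j * e t * \<phi> \<in> V"
    "\<And>t \<phi>. 0 < t \<Longrightarrow> \<phi> \<in> V \<Longrightarrow> t ^ j * \<nu> (a ^ j * e t * \<phi>) \<le> C * \<nu> \<phi>" by blast
  have "a ^ Suc j * e t * \<phi> \<in> V \<and>
      t ^ Suc j * \<nu> (a ^ Suc j * e t * \<phi>) \<le> (2 ^ Suc j * \<bar>N\<bar> * C) * \<nu> \<phi>"
    if "0 < t" "\<phi> \<in> V" for t \<phi>
  proof -
    let ?h = "t / 2" and ?\<psi> = "a ^ j * e (t / 2) * \<phi>"
    have h: "0 < ?h" "?\<psi> \<in> V" using that C(2)[of ?h] by auto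
    have eq: "a ^ Suc j * e t * \<phi> = a * e ?h * ?\<psi>"
      using e_add[of ?h ?h] by (simp add: mult_ac)
    have "?h ^ Suc j * \<nu> (a * e ?h * ?\<psi>) = ?h ^ j * (?h * \<nu> (a * e ?h * ?\<psi>))" by simp
    also have "\<dots> \<le> ?h ^ j * (N * \<nu> ?\<psi>)"
      using h by (intro mult_left_mono e_smoothing_bound) auto
    also have "\<dots> \<le> ?h ^ j * (\<bar>N\<bar> * \<nu> ?\<psi>)"
      using h nu_nonneg[OF h(2)] by (intro mult_left_mono mult_right_mono) auto
    also have "\<dots> = \<bar>N\<bar> * (?h ^ j * \<nu> ?\<psi>)" by simp
    also have "\<dots> \<le> \<bar>N\<bar> * (C * \<nu> \<phi>)" using h(1) that(2) by (intro mult_left_mono C(3)) auto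
    finally have le: "?h ^ Suc j * \<nu> (a * e ?h * ?\<psi>) \<le> \<bar>N\<bar> * (C * \<nu> \<phi>)" .
    have "t ^ Suc j * \<nu> (a * e ?h * ?\<psi>) = 2 ^ Suc j * (?h ^ Suc j * \<nu> (a * e ?h * ?\<psi>))"
      by (simp add: power_divide)
    also have "\<dots> \<le> 2 ^ Suc j * (\<bar>N\<bar> * (C * \<nu> \<phi>))"
      using le by (rule mult_left_mono) simp
    also have "\<dots> = (2 ^ Suc j * \<bar>N\<bar> * C) * \<nu> \<phi>" by simp
    finally show ?thesis unfolding eq using e_smoothing[OF h] by blast
  qed
  then show ?case using C(1) by (intro exI[of _ "2 ^ Suc j * \<bar>N\<bar> * C"]) auto
qed

lemma smoothing_V: "0 < t \<Longrightarrow> \<phi> \<in> V \<Longrightarrow> a ^ j * e t * \<phi> \<in> V"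
  using smoothing_power[of j] by blast

text \<open>
  \<open>1 - (1 - e u)\<^sup>j\<close> is a multiple of \<open>e u\<close>. This is why \<open>\<phi>\<close> itself need not lie in
  \<open>V\<close>: the lemma is applied to \<open>a\<^sup>r * \<phi>\<close>, of which only the smoothed version
  \<open>e u * a\<^sup>r * \<phi>\<close> is known to be in \<open>V\<close>.
\<close>

lemma boolean_sum_bound:
  assumes "0 < u" "e u * \<phi> \<in> V"
  shows "\<phi> - (1 - e u) ^ j * \<phi> \<in> V \<and> \<nu> (\<phi> - (1 - e u) ^ j * \<phi>) \<le> 2 ^ j * \<nu> (e u * \<phi>)"
proof (induction j)
  case 0
  show ?case using nu_scale[OF assms(2), of 0] V_scale[OF assms(2), of 0] nu_nonneg[OF assms(2)]
    by simp
next
  case (Suc j)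
  have eq: "\<phi> - (1 - e u) ^ Suc j * \<phi> = (\<phi> - (1 - e u) ^ j * \<phi>) + (1 - e u) ^ j * (e u * \<phi>)"
    by (simp add: algebra_simps)
  have V: "(1 - e u) ^ j * (e u * \<phi>) \<in> V" by (intro boolean_V assms)
  have "\<nu> (\<phi> - (1 - e u) ^ Suc j * \<phi>) \<le> \<nu> (\<phi> - (1 - e u) ^ j * \<phi>) + \<nu> ((1 - e u) ^ j * (e u * \<phi>))"
    unfolding eq using Suc V by (intro nu_triangle) auto
  also have "\<dots> \<le> 2 ^ j * \<nu> (e u * \<phi>) + 2 ^ j * \<nu> (e u * \<phi>)"
    using Suc assms by (intro add_mono boolean_bound) auto
  finally show ?case using Suc V unfolding eq by (auto intro!: V_add)
qed

definition K :: "nat \<Rightarrow> 'r \<Rightarrow> real \<Rightarrow> real" where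
  "K r \<phi> s = (INF \<psi>\<in>{\<psi> \<in> V. a ^ r * \<psi> \<in> V}. \<nu> (\<phi> - \<psi>) + s * \<nu> (a ^ r * \<psi>))"

text \<open>
  \<open>increment_power_bound\<close> requires all intermediate powers \<open>a\<^sup>i * \<psi>\<close> with \<open>i < r\<close> to
  lie in \<open>V\<close>, which the hypothesis on \<open>a\<^sup>r * \<psi>\<close> does not provide. For the smoothed element
  \<open>e \<epsilon> * \<psi>\<close> they do, and \<open>\<epsilon>\<close> then tends to \<open>0\<close>.
\<close>

lemma boolean_power_le_generator_power:
  assumes "0 < t" "\<psi> \<in> V" "a ^ r * \<psi> \<in> V"
  shows "\<nu> ((1 - e t) ^ r * \<psi>) \<le> t ^ r * \<nu> (a ^ r * \<psi>)"
proof -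
  have lim: "((\<lambda>\<epsilon>. t ^ r * \<nu> (a ^ r * \<psi>) + 2 ^ r * \<nu> (e \<epsilon> * \<psi> - \<psi>)) \<longlongrightarrow>
      t ^ r * \<nu> (a ^ r * \<psi>) + 2 ^ r * 0) (at_right 0)"
    by (intro tendsto_intros e_continuous assms)
  have "\<nu> ((1 - e t) ^ r * \<psi>) \<le> t ^ r * \<nu> (a ^ r * \<psi>) + 2 ^ r * \<nu> (e \<epsilon> * \<psi> - \<psi>)" if "0 < \<epsilon>" for \<epsilon>
  proof -
    have V: "e \<epsilon> * \<psi> \<in> V" "e \<epsilon> * \<psi> - \<psi> \<in> V" using that assms by (auto intro!: e_V V_diff)
    have eq: "(1 - e t) ^ r * \<psi> = (1 - e t) ^ r * (e \<epsilon> * \<psi>) - (1 - e t) ^ r * (e \<epsilon> * \<psi> - \<psi>)"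
      by (simp add: algebra_simps)
    have "\<nu> ((1 - e t) ^ r * \<psi>) \<le>
        \<nu> ((1 - e t) ^ r * (e \<epsilon> * \<psi>)) + \<nu> ((1 - e t) ^ r * (e \<epsilon> * \<psi> - \<psi>))"
      by (subst eq, intro nu_diff boolean_V assms V)
    also have "\<nu> ((1 - e t) ^ r * (e \<epsilon> * \<psi>)) \<le> t ^ r * \<nu> (a ^ r * (e \<epsilon> * \<psi>))"
      using assms(1) smoothing_V[OF that assms(2)] by (intro increment_power_bound) (simp_all add: mult_ac)
    also have "a ^ r * (e \<epsilon> * \<psi>) = e \<epsilon> * (a ^ r * \<psi>)" by (simp add: mult_ac)
    also have "t ^ r * \<nu> \<dots> \<le> t ^ r * \<nu> (a ^ r * \<psi>)"
      using assms that by (intro mult_left_mono e_contractive) auto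
    also have "\<nu> ((1 - e t) ^ r * (e \<epsilon> * \<psi> - \<psi>)) \<le> 2 ^ r * \<nu> (e \<epsilon> * \<psi> - \<psi>)"
      by (intro boolean_bound assms V)
    finally show ?thesis by simp
  qed
  then have "\<forall>\<^sub>F \<epsilon> in at_right 0. \<nu> ((1 - e t) ^ r * \<psi>) \<le> t ^ r * \<nu> (a ^ r * \<psi>) + 2 ^ r * \<nu> (e \<epsilon> * \<psi> - \<psi>)"
    by (auto simp: eventually_at_right_less intro: eventually_mono[OF eventually_at_right_less])
  from tendsto_lowerbound[OF lim this] show ?thesis by simp
qed

lemma direct_estimate:
  assumes "0 < t" "\<phi> \<in> V"
  shows "\<nu> ((1 - e t) ^ r * \<phi>) \<le> 2 ^ r * K r \<phi> (t ^ r)"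
proof -
  have "\<nu> ((1 - e t) ^ r * \<phi>) / 2 ^ r \<le> K r \<phi> (t ^ r)"
    unfolding K_def
  proof (rule cINF_greatest)
    have "a ^ r * (e 1 * \<phi>) \<in> V" "e 1 * \<phi> \<in> V"
      using smoothing_V[of 1 \<phi> r] e_V[of 1 \<phi>] assms by (simp_all add: mult_ac)
    then show "{\<psi> \<in> V. a ^ r * \<psi> \<in> V} \<noteq> {}" by blast
    fix \<psi> assume "\<psi> \<in> {\<psi> \<in> V. a ^ r * \<psi> \<in> V}"
    then have \<psi>: "\<psi> \<in> V" "a ^ r * \<psi> \<in> V" by auto
    have eq: "(1 - e t) ^ r * \<phi> = (1 - e t) ^ r * (\<phi> - \<psi>) + (1 - e t) ^ r * \<psi>"
      by (simp add: algebra_simps)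
    have "\<nu> ((1 - e t) ^ r * \<phi>) \<le> \<nu> ((1 - e t) ^ r * (\<phi> - \<psi>)) + \<nu> ((1 - e t) ^ r * \<psi>)"
      by (subst eq, intro nu_triangle boolean_V V_diff assms \<psi>)
    also have "\<dots> \<le> 2 ^ r * \<nu> (\<phi> - \<psi>) + t ^ r * \<nu> (a ^ r * \<psi>)"
      by (intro add_mono boolean_bound boolean_power_le_generator_power V_diff assms \<psi>)
    also have "\<dots> \<le> 2 ^ r * \<nu> (\<phi> - \<psi>) + 2 ^ r * (t ^ r * \<nu> (a ^ r * \<psi>))"
      using nu_nonneg[OF \<psi>(2)] assms(1)
        mult_right_mono[of 1 "2 ^ r" "t ^ r * \<nu> (a ^ r * \<psi>)"] by simp
    finally show "\<nu> ((1 - e t) ^ r * \<phi>) / 2 ^ r \<le> \<nu> (\<phi> - \<psi>) + t ^ r * \<nu> (a ^ r * \<psi>)"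
      by (simp add: field_simps)
  qed
  then show ?thesis by (simp add: field_simps)
qed

text \<open>
  The absorption argument. With \<open>p + 1\<close> steps of length \<open>t\<close>, let \<open>x\<close> be the quantity to
  be bounded and \<open>y\<close> the same quantity after one step only. Splitting off
  \<open>(1 - e (p t))\<^sup>r\<close> gives \<open>y \<le> const * d + 2\<^sup>r * x\<close>, and Taylor expansion together with
  the smoothing bound for the last \<open>p\<close> steps gives \<open>x \<le> d + r * \<bar>N\<bar> / p * y\<close>. The factor
  \<open>2\<^sup>r\<close> is independent of \<open>p\<close>, so for large \<open>p\<close> the term in \<open>x\<close> on the right is at
  most \<open>x / 2\<close>.
\<close>

lemma generator_power_le_boolean_power:
  "\<exists>p>0. \<exists>C\<ge>0. \<forall>t>0. \<forall>\<phi>\<in>V.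
     t ^ r * \<nu> (a ^ r * e (real p * t) * \<phi>) \<le> C * \<nu> ((1 - e t) ^ r * \<phi>)"
proof -
  obtain C where C: "0 \<le> C" "\<And>t \<phi>. 0 < t \<Longrightarrow> \<phi> \<in> V \<Longrightarrow> t ^ r * \<nu> (a ^ r * e t * \<phi>) \<le> C * \<nu> \<phi>"
    using smoothing_power[of r] by blast
  \<comment> \<open>chosen so that the coefficient of \<open>x\<close> on the right of the final estimate is at most \<open>1 / 2\<close>\<close>
  obtain p :: nat where p: "2 * real r * \<bar>N\<bar> * 2 ^ r + 1 \<le> real p"
    using real_arch_simple by blast
  have p0: "0 < p"
  proof -
    have "0 \<le> 2 * real r * \<bar>N\<bar> * 2 ^ r" by simp
    then have "0 < real p" using p by linarith
    then show ?thesis by simp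
  qed
  have "t ^ r * \<nu> (a ^ r * e (real (Suc p) * t) * \<phi>) \<le>
      (2 + 2 * real r * \<bar>N\<bar> * C * real p ^ r) * \<nu> ((1 - e t) ^ r * \<phi>)"
    if t: "0 < t" and \<phi>: "\<phi> \<in> V" for t \<phi>
  proof -
    define d where "d = \<nu> ((1 - e t) ^ r * \<phi>)"
    define g where "g = e (real (Suc p) * t) * \<phi>"
    define x where "x = t ^ r * \<nu> (a ^ r * g)"
    define y where "y = t ^ r * \<nu> (a ^ r * e t * \<phi>)"
    have pt: "0 < real p * t" "0 < real (Suc p) * t" using p0 t by simp_all
    have g: "a ^ i * g \<in> V" for i
      using smoothing_V[OF pt(2) \<phi>, of i] by (simp add: g_def mult_ac)
    have g_split: "g = e (real p * t) * (e t * \<phi>)"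
      using e_add[of "real p * t" t] by (simp add: g_def algebra_simps)
    have d0: "0 \<le> d" unfolding d_def by (intro nu_nonneg boolean_V t \<phi>)
    have x0: "0 \<le> x" unfolding x_def using t nu_nonneg[OF g[of r]] by simp
    have y: "y \<le> C * (real p ^ r * d) + 2 ^ r * x"
    proof -
      let ?B = "(1 - e (real p * t)) ^ r"
      let ?\<chi> = "a ^ r * e t * \<phi>"
      have "e (real p * t) * ?\<chi> = a ^ r * g" by (simp add: g_split mult_ac)
      then have \<chi>: "?\<chi> - ?B * ?\<chi> \<in> V" "\<nu> (?\<chi> - ?B * ?\<chi>) \<le> 2 ^ r * \<nu> (a ^ r * g)"
        using boolean_sum_bound[OF pt(1), of ?\<chi> r] g[of r] by simp_all
      have B: "?B * \<phi> \<in> V" by (intro boolean_V pt \<phi>)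
      \<comment> \<open>the second summand is a multiple of \<open>e (p t) * \<chi>\<close>, which is \<open>a\<^sup>r * g\<close>, hence of size \<open>x\<close>\<close>
      have eq: "?\<chi> = a ^ r * e t * (?B * \<phi>) + (?\<chi> - ?B * ?\<chi>)" by (simp add: mult_ac)
      have "\<nu> ?\<chi> \<le> \<nu> (a ^ r * e t * (?B * \<phi>)) + \<nu> (?\<chi> - ?B * ?\<chi>)"
        by (subst eq, intro nu_triangle smoothing_V t B \<chi>(1))
      then have "y \<le> t ^ r * (\<nu> (a ^ r * e t * (?B * \<phi>)) + \<nu> (?\<chi> - ?B * ?\<chi>))"
        unfolding y_def using t by (intro mult_left_mono) auto
      also have "\<dots> = t ^ r * \<nu> (a ^ r * e t * (?B * \<phi>)) + t ^ r * \<nu> (?\<chi> - ?B * ?\<chi>)"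
        by (simp add: algebra_simps)
      also have "\<dots> \<le> C * \<nu> (?B * \<phi>) + t ^ r * (2 ^ r * \<nu> (a ^ r * g))"
        using t by (intro add_mono C(2) t B mult_left_mono \<chi>(2)) auto
      also have "C * \<nu> (?B * \<phi>) \<le> C * (real p ^ r * d)"
        unfolding d_def by (intro mult_left_mono increment_multiple_power t \<phi> p0 C(1))
      finally show ?thesis by (simp add: x_def mult_ac)
    qed
    have z: "real p * (t ^ Suc r * \<nu> (a ^ Suc r * g)) \<le> \<bar>N\<bar> * y"
    proof -
      have \<chi>: "a ^ r * e t * \<phi> \<in> V" by (intro smoothing_V t \<phi>)
      have "real p * (t ^ Suc r * \<nu> (a ^ Suc r * g)) =
          t ^ r * ((real p * t) * \<nu> (a * e (real p * t) * (a ^ r * e t * \<phi>)))"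
        by (simp add: g_split mult_ac)
      also have "\<dots> \<le> t ^ r * (N * \<nu> (a ^ r * e t * \<phi>))"
        using t by (intro mult_left_mono e_smoothing_bound pt \<chi>) auto
      also have "\<dots> \<le> t ^ r * (\<bar>N\<bar> * \<nu> (a ^ r * e t * \<phi>))"
        using t nu_nonneg[OF \<chi>] by (intro mult_left_mono mult_right_mono) auto
      finally show ?thesis by (simp add: y_def mult_ac)
    qed
    have x: "x \<le> d + real r * (t ^ Suc r * \<nu> (a ^ Suc r * g))"
    proof -
      have eg: "(1 - e t) ^ r * \<phi> \<in> V" by (intro boolean_V t \<phi>)
      have R: "\<nu> (((e t - 1) ^ r - (cst t * a) ^ r) * g) \<le> real r * t ^ Suc r * \<nu> (a ^ Suc r * g)"
        "((e t - 1) ^ r - (cst t * a) ^ r) * g \<in> V"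
        using increment_power_remainder[OF t g, of r] by blast+
      have sgn: "(e t - 1) ^ r = cst ((-1) ^ r) * (1 - e t) ^ r"
        by (simp add: cst_power cst_uminus power_mult_distrib[symmetric])
      have V: "(1 - e t) ^ r * g \<in> V" using g[of 0] by (intro boolean_V t) simp
      have "x = \<nu> (cst (t ^ r) * (a ^ r * g))"
        unfolding x_def using t g[of r] by (simp add: nu_scale)
      also have "cst (t ^ r) * (a ^ r * g) = (e t - 1) ^ r * g - ((e t - 1) ^ r - (cst t * a) ^ r) * g"
        by (simp add: algebra_simps power_mult_distrib cst_power)
      also have "\<nu> \<dots> \<le> \<nu> ((e t - 1) ^ r * g) + \<nu> (((e t - 1) ^ r - (cst t * a) ^ r) * g)"
        using V R(2) unfolding sgn mult.assoc by (intro nu_diff V_scale)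
      also have "\<nu> ((e t - 1) ^ r * g) = \<nu> ((1 - e t) ^ r * g)"
        using V unfolding sgn mult.assoc by (simp add: nu_scale power_abs)
      also have "(1 - e t) ^ r * g = e (real (Suc p) * t) * ((1 - e t) ^ r * \<phi>)"
        by (simp add: g_def mult_ac)
      also have "\<nu> \<dots> \<le> d" unfolding d_def by (intro e_contractive pt eg)
      finally show ?thesis using R(1) by (simp add: mult_ac)
    qed
    have *: "real p * x \<le> real p * d + real r * (\<bar>N\<bar> * (C * (real p ^ r * d) + 2 ^ r * x))"
    proof -
      have "real p * x \<le> real p * (d + real r * (t ^ Suc r * \<nu> (a ^ Suc r * g)))"
        using x by (rule mult_left_mono) simp
      also have "\<dots> = real p * d + real r * (real p * (t ^ Suc r * \<nu> (a ^ Suc r * g)))"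
        by (simp add: algebra_simps)
      also have "\<dots> \<le> real p * d + real r * (\<bar>N\<bar> * (C * (real p ^ r * d) + 2 ^ r * x))"
        using order_trans[OF z mult_left_mono[OF y abs_ge_zero]]
        by (intro add_left_mono mult_left_mono) auto
      finally show ?thesis .
    qed
    have "2 * (real r * \<bar>N\<bar> * 2 ^ r) * x \<le> real p * x"
      using p x0 by (intro mult_right_mono) auto
    with * have "real p * x \<le> real p * (2 * d) + 2 * real r * \<bar>N\<bar> * C * real p ^ r * d"
      by (simp add: algebra_simps)
    also have "\<dots> \<le> real p * (2 * d) + real p * (2 * real r * \<bar>N\<bar> * C * real p ^ r * d)"
    proof -
      have "0 \<le> 2 * real r * \<bar>N\<bar> * C * real p ^ r * d" using C(1) d0 by simp
      then have "1 * (2 * real r * \<bar>N\<bar> * C * real p ^ r * d) \<le> real p * (2 * real r * \<bar>N\<bar> * C * real p ^ r * d)"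
        using p0 by (intro mult_right_mono) auto
      then show ?thesis by simp
    qed
    also have "\<dots> = real p * ((2 + 2 * real r * \<bar>N\<bar> * C * real p ^ r) * d)"
      by (simp add: algebra_simps)
    finally have "x \<le> (2 + 2 * real r * \<bar>N\<bar> * C * real p ^ r) * d" using p0 by simp
    then show ?thesis by (simp add: x_def d_def g_def mult_ac)
  qed
  then show ?thesis using C(1)
    by (intro exI[of _ "Suc p"] conjI exI[of _ "2 + 2 * real r * \<bar>N\<bar> * C * real p ^ r"]) auto
qed

text \<open>
  The competitor in the \<open>K\<close>-functional is the Boolean sum \<open>\<phi> - (1 - e (p t))\<^sup>r * \<phi>\<close> with the
  \<open>p\<close> of the preceding lemma.
\<close>

lemma converse_estimate:
  "\<exists>C>0. \<forall>t>0. \<forall>\<phi>\<in>V. K r \<phi> (t ^ r) \<le> C * \<nu> ((1 - e t) ^ r * \<phi>)"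
proof -
  obtain p C where p: "0 < p" and C: "0 \<le> C"
    and bound: "\<And>t \<phi>. 0 < t \<Longrightarrow> \<phi> \<in> V \<Longrightarrow>
      t ^ r * \<nu> (a ^ r * e (real p * t) * \<phi>) \<le> C * \<nu> ((1 - e t) ^ r * \<phi>)"
    using generator_power_le_boolean_power[of r] by blast
  have "K r \<phi> (t ^ r) \<le> (real p ^ r + 2 ^ r * C) * \<nu> ((1 - e t) ^ r * \<phi>)"
    if t: "0 < t" and \<phi>: "\<phi> \<in> V" for t \<phi>
  proof -
    have pt: "0 < real p * t" using p t by simp
    let ?B = "(1 - e (real p * t)) ^ r"
    let ?\<psi> = "\<phi> - ?B * \<phi>"
    have eq: "a ^ r * ?\<psi> = a ^ r * \<phi> - ?B * (a ^ r * \<phi>)" by (simp add: algebra_simps)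
    have s: "e (real p * t) * (a ^ r * \<phi>) = a ^ r * e (real p * t) * \<phi>" by (simp add: mult_ac)
    have \<psi>: "a ^ r * ?\<psi> \<in> V" "\<nu> (a ^ r * ?\<psi>) \<le> 2 ^ r * \<nu> (a ^ r * e (real p * t) * \<phi>)"
      unfolding eq using boolean_sum_bound[OF pt, of "a ^ r * \<phi>" r] smoothing_V[OF pt \<phi>, of r]
      unfolding s by auto
    have "?\<psi> \<in> V" by (intro V_diff boolean_V pt \<phi>)
    then have "K r \<phi> (t ^ r) \<le> \<nu> (\<phi> - ?\<psi>) + t ^ r * \<nu> (a ^ r * ?\<psi>)"
      unfolding K_def using \<psi>(1) t \<phi>
      by (intro cINF_lower bdd_belowI2[of _ 0]) (auto intro!: add_nonneg_nonneg mult_nonneg_nonneg nu_nonneg V_diff)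
    also have "\<phi> - ?\<psi> = ?B * \<phi>" by simp
    also have "\<nu> (?B * \<phi>) \<le> real p ^ r * \<nu> ((1 - e t) ^ r * \<phi>)"
      by (intro increment_multiple_power t \<phi> p)
    also have "t ^ r * \<nu> (a ^ r * ?\<psi>) \<le> t ^ r * (2 ^ r * \<nu> (a ^ r * e (real p * t) * \<phi>))"
      using t \<psi>(2) by (intro mult_left_mono) auto
    also have "\<dots> = 2 ^ r * (t ^ r * \<nu> (a ^ r * e (real p * t) * \<phi>))" by simp
    also have "\<dots> \<le> 2 ^ r * (C * \<nu> ((1 - e t) ^ r * \<phi>))"
      by (intro mult_left_mono bound t \<phi>) auto
    finally show ?thesis by (simp add: algebra_simps)
  qed
  moreover have "0 < real p ^ r + 2 ^ r * C" using p C by (intro add_pos_nonneg) auto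
  ultimately show ?thesis by blast
qed

end

section \<open>Completeness of the spherical harmonics\<close>

lemma finite_measure_sphere_measure: "finite_measure (sphere_measure :: 'a::euclidean_space measure)"
  by (rule finite_measureI) (simp add: space_sphere_measure emeasure_sphere_measure_total)

lemma borel_measurable_sphere_measure_continuous:
  fixes g :: "'a::euclidean_space \<Rightarrow> 'b::topological_space"
  assumes "continuous_on (sphere 0 1) g"
  shows "g \<in> borel_measurable sphere_measure"
  using borel_measurable_continuous_on_restrict[OF assms]
  by (simp add: measurable_cong_sets[OF sets_sphere_measure refl])

lemma integrable_continuous_times:
  fixes f :: "'a::euclidean_space \<Rightarrow> complex" and g :: "'a \<Rightarrow> complex"
  assumes f: "integrable sphere_measure f" and g: "continuous_on (sphere 0 1) g"
  shows "integrable sphere_measure (\<lambda>y. g y * f y)"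
proof -
  have "bounded (g ` sphere 0 1)"
    by (intro compact_imp_bounded compact_continuous_image g compact_sphere)
  then obtain B where B: "\<And>y. y \<in> sphere 0 1 \<Longrightarrow> norm (g y) \<le> B"
    unfolding bounded_iff by blast
  show ?thesis
  proof (rule Bochner_Integration.integrable_bound)
    show "integrable sphere_measure (\<lambda>y. B * norm (f y))" using f by simp
    show "(\<lambda>y. g y * f y) \<in> borel_measurable sphere_measure"
      using borel_measurable_sphere_measure_continuous[OF g] f by measurable
    show "AE y in sphere_measure. norm (g y * f y) \<le> norm (B * norm (f y))"
      using B by (intro AE_I2) (auto simp: space_sphere_measure norm_mult
        intro!: mult_right_mono order_trans[OF _ abs_ge_self])
  qed
qed

text \<open>
  The coefficients of \<open>(X\<^sup>2 - 2 t X)\<^sup>i\<close> are polynomials in \<open>t\<close> of degree at most \<open>i\<close>.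
  In the expansion of \<open>(1 - 2 t X + X\<^sup>2) powr (- l)\<close> only \<open>i \<le> k\<close> contribute to the
  coefficient of \<open>X\<^sup>k\<close>, so its term in \<open>t\<^sup>k\<close> can come only from \<open>i = k\<close>.
\<close>

lemma gegenbauer_power_coefficient:
  "\<exists>p :: real poly. degree p \<le> i \<and>
     (\<forall>t. fps_nth ((fps_X ^ 2 - fps_const (2 * t) * fps_X) ^ i) k = poly p t)"
proof (induction i arbitrary: k)
  case 0
  show ?case by (cases k) (auto intro: exI[of _ 0] exI[of _ 1])
next
  case (Suc i)
  obtain p :: "nat \<Rightarrow> real poly" where p: "\<And>k. degree (p k) \<le> i"
    "\<And>k t. fps_nth ((fps_X ^ 2 - fps_const (2 * t) * fps_X) ^ i) k = poly (p k) t"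
    using Suc by metis
  define q where "q = (if k < 2 then 0 else p (k - 2)) - [:0, 2:] * (if k = 0 then 0 else p (k - 1))"
  have "degree q \<le> Suc i"
    unfolding q_def using p(1)[of "k - 1"] p(1)[of "k - 2"]
    by (intro degree_diff_le order_trans[OF degree_mult_le]) auto
  moreover have "fps_nth ((fps_X ^ 2 - fps_const (2 * t) * fps_X) ^ Suc i) k = poly q t" for t
  proof -
    let ?Q = "(fps_X ^ 2 - fps_const (2 * t) * fps_X) ^ i"
    have eq: "(fps_X ^ 2 - fps_const (2 * t) * fps_X) ^ Suc i =
        fps_X ^ 2 * ?Q - fps_const (2 * t) * (fps_X * ?Q)"
      by (simp add: algebra_simps)
    show ?thesis
      unfolding eq by (simp add: q_def p(2) fps_X_power_mult_nth)
  qed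
  ultimately show ?case by blast
qed

text \<open>
  The factor \<open>(- l) gchoose k\<close> of the leading coefficient is a product of the numbers
  \<open>- l - i\<close>, up to a factorial; it does not vanish because \<open>l\<close> is positive. For
  \<open>l = 0\<close>, the case of the circle, the polynomials of positive degree would vanish.
\<close>

lemma gegenbauer_leading_term:
  assumes "0 < l"
  shows "\<exists>c b. c \<noteq> 0 \<and> (\<forall>t. gegenbauer l k t = c * t ^ k + (\<Sum>j<k. b j * t ^ j))"
proof -
  let ?u = "\<lambda>t. fps_X ^ 2 - fps_const (2 * t) * fps_X :: real fps"
  obtain p :: "nat \<Rightarrow> real poly" where p: "\<And>i. degree (p i) \<le> i" "\<And>i t. fps_nth (?u t ^ i) k = poly (p i) t"
    using gegenbauer_power_coefficient[where k = k] by metis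
  define c where "c = ((- l) gchoose k) * (-2) ^ k"
  define b where "b j = (\<Sum>i<k. ((- l) gchoose i) * coeff (p i) j)" for j
  have "c \<noteq> 0"
    using assms by (auto simp: c_def gbinomial_prod_rev)
  moreover have "gegenbauer l k t = c * t ^ k + (\<Sum>j<k. b j * t ^ j)" for t
  proof -
    have "fps_nth (?u t ^ k) k = (-2) ^ k * t ^ k"
      by (subst startsby_zero_power_nth_same) (simp_all add: power_mult_distrib[symmetric])
    moreover have "poly (p i) t = (\<Sum>j<k. coeff (p i) j * t ^ j)" if "i < k" for i
      unfolding poly_altdef using that p(1)[of i]
      by (intro sum.mono_neutral_left) (auto intro: coeff_eq_0)
    moreover have "{0..k} = insert k {..<k}" by auto
    ultimately have "gegenbauer l k t =
        c * t ^ k + (\<Sum>i<k. ((- l) gchoose i) * (\<Sum>j<k. coeff (p i) j * t ^ j))"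
      by (simp add: gegenbauer_def fps_compose_nth c_def p(2))
    also have "(\<Sum>i<k. ((- l) gchoose i) * (\<Sum>j<k. coeff (p i) j * t ^ j)) = (\<Sum>j<k. b j * t ^ j)"
      unfolding b_def sum_distrib_left sum_distrib_right mult.assoc by (rule sum.swap)
    finally show ?thesis .
  qed
  ultimately show ?thesis by blast
qed

lemma continuous_gegenbauer: "continuous_on S (gegenbauer l k)"
proof -
  let ?u = "\<lambda>t. fps_X ^ 2 - fps_const (2 * t) * fps_X :: real fps"
  obtain p :: "nat \<Rightarrow> real poly" where "\<And>i t. fps_nth (?u t ^ i) k = poly (p i) t"
    using gegenbauer_power_coefficient[where k = k] by metis
  then have "gegenbauer l k = (\<lambda>t. \<Sum>i=0..k. ((- l) gchoose i) * poly (p i) t)"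
    by (simp add: fun_eq_iff gegenbauer_def fps_compose_nth)
  then show ?thesis by (auto intro!: continuous_intros)
qed

lemma powers_annihilated:
  fixes f :: "'a::euclidean_space \<Rightarrow> complex"
  assumes f: "integrable sphere_measure f" and l: "0 < l"
    and ann: "\<And>k. (\<integral>y. complex_of_real (gegenbauer l k (x \<bullet> y)) * f y \<partial>sphere_measure) = 0"
  shows "(\<integral>y. complex_of_real ((x \<bullet> y) ^ m) * f y \<partial>sphere_measure) = 0"
proof (induction m rule: less_induct)
  case (less m)
  obtain c b where c: "c \<noteq> 0"
    and eq: "\<And>t. gegenbauer l m t = c * t ^ m + (\<Sum>j<m. b j * t ^ j)"
    using gegenbauer_leading_term[OF l, of m] by blast
  have int: "integrable sphere_measure (\<lambda>y. complex_of_real ((x \<bullet> y) ^ j) * f y)" for j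
    by (intro integrable_continuous_times f continuous_intros)
  have "0 = (\<integral>y. complex_of_real (gegenbauer l m (x \<bullet> y)) * f y \<partial>sphere_measure)"
    using ann by simp
  also have "\<dots> = (\<integral>y. complex_of_real c * (complex_of_real ((x \<bullet> y) ^ m) * f y) +
      (\<Sum>j<m. complex_of_real (b j) * (complex_of_real ((x \<bullet> y) ^ j) * f y)) \<partial>sphere_measure)"
    by (simp add: eq ring_distribs sum_distrib_right mult.assoc)
  also have "\<dots> = complex_of_real c * (\<integral>y. complex_of_real ((x \<bullet> y) ^ m) * f y \<partial>sphere_measure) +
      (\<Sum>j<m. complex_of_real (b j) * (\<integral>y. complex_of_real ((x \<bullet> y) ^ j) * f y \<partial>sphere_measure))"
    using int by (subst Bochner_Integration.integral_add) (auto simp del: of_real_power)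
  also have "(\<Sum>j<m. complex_of_real (b j) *
      (\<integral>y. complex_of_real ((x \<bullet> y) ^ j) * f y \<partial>sphere_measure)) = 0"
    using less by (intro sum.neutral) auto
  finally show ?case using c by simp
qed

lemma exponentials_annihilated:
  fixes f :: "'a::euclidean_space \<Rightarrow> complex"
  assumes f: "integrable sphere_measure f"
    and ann: "\<And>x m. norm x = 1 \<Longrightarrow> (\<integral>y. complex_of_real ((x \<bullet> y) ^ m) * f y \<partial>sphere_measure) = 0"
  shows "(\<integral>y. complex_of_real (exp (z \<bullet> y)) * f y \<partial>sphere_measure) = 0"
proof -
  have ann_z: "(\<integral>y. complex_of_real ((z \<bullet> y) ^ m) * f y \<partial>sphere_measure) = 0" for m
  proof -
    obtain x :: 'a and s where x: "norm x = 1" and z: "z = s *\<^sub>R x"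
    proof (cases "z = 0")
      case True
      then show ?thesis using that[of "SOME b. b \<in> Basis" 0] by (simp add: SOME_Basis)
    next
      case False
      then show ?thesis using that[of "z /\<^sub>R norm z" "norm z"] by simp
    qed
    have "(\<integral>y. complex_of_real ((z \<bullet> y) ^ m) * f y \<partial>sphere_measure) =
        (\<integral>y. complex_of_real (s ^ m) * (complex_of_real ((x \<bullet> y) ^ m) * f y) \<partial>sphere_measure)"
      by (simp add: z power_mult_distrib mult.assoc)
    also have "\<dots> = complex_of_real (s ^ m) * (\<integral>y. complex_of_real ((x \<bullet> y) ^ m) * f y \<partial>sphere_measure)"
      by (rule integral_mult_right_zero)
    finally show ?thesis using ann[OF x] by simp
  qed
  let ?s = "\<lambda>n y. complex_of_real (\<Sum>j<n. (z \<bullet> y) ^ j / fact j) * f y"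
  have cont: "continuous_on (sphere 0 1) (\<lambda>y. complex_of_real (\<Sum>j<n. (z \<bullet> y) ^ j / fact j))" for n
    by (intro continuous_intros) auto
  have "(\<lambda>n. \<integral>y. ?s n y \<partial>sphere_measure) \<longlonglongrightarrow>
      (\<integral>y. complex_of_real (exp (z \<bullet> y)) * f y \<partial>sphere_measure)"
  proof (rule integral_dominated_convergence)
    show "(\<lambda>y. complex_of_real (exp (z \<bullet> y)) * f y) \<in> borel_measurable sphere_measure"
      by (intro borel_measurable_integrable integrable_continuous_times f continuous_intros)
    show "?s n \<in> borel_measurable sphere_measure" for n
      by (intro borel_measurable_integrable integrable_continuous_times f cont)
    show "integrable sphere_measure (\<lambda>y. exp (norm z) * norm (f y))" using f by simp
    show "AE y in sphere_measure. (\<lambda>n. ?s n y) \<longlonglongrightarrow> complex_of_real (exp (z \<bullet> y)) * f y"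
    proof (intro AE_I2 tendsto_intros)
      fix y show "(\<lambda>n. \<Sum>j<n. (z \<bullet> y) ^ j / fact j) \<longlonglongrightarrow> exp (z \<bullet> y)"
        using exp_converges[of "z \<bullet> y"] by (simp add: sums_def divide_inverse mult.commute)
    qed
    fix n
    show "AE y in sphere_measure. norm (?s n y) \<le> exp (norm z) * norm (f y)"
    proof (intro AE_I2)
      fix y :: 'a assume "y \<in> space sphere_measure"
      then have y: "norm y = 1" by (simp add: space_sphere_measure)
      have "\<bar>\<Sum>j<n. (z \<bullet> y) ^ j / fact j\<bar> \<le> (\<Sum>j<n. \<bar>z \<bullet> y\<bar> ^ j / fact j)"
        by (rule order_trans[OF sum_abs]) (simp add: power_abs)
      also have "\<dots> \<le> (\<Sum>j<n. norm z ^ j / fact j)"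
        using Cauchy_Schwarz_ineq2[of z y] y by (intro sum_mono divide_right_mono power_mono) auto
      also have "\<dots> \<le> exp (norm z)"
        using exp_converges[of "norm z"] by (intro sum_le_suminf[THEN order_trans])
          (auto simp: sums_iff divide_inverse mult.commute)
      finally show "norm (?s n y) \<le> exp (norm z) * norm (f y)"
        by (simp add: norm_mult mult_right_mono del: of_real_sum)
    qed
  qed
  moreover have "(\<integral>y. ?s n y \<partial>sphere_measure) = 0" for n
  proof -
    have int: "integrable sphere_measure (\<lambda>y. complex_of_real ((z \<bullet> y) ^ j) * f y)" for j
      by (intro integrable_continuous_times f continuous_intros)
    have "(\<integral>y. ?s n y \<partial>sphere_measure) =
        (\<integral>y. (\<Sum>j<n. complex_of_real (1 / fact j) * (complex_of_real ((z \<bullet> y) ^ j) * f y)) \<partial>sphere_measure)"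
      by (simp add: sum_distrib_right)
    also have "\<dots> = (\<Sum>j<n. complex_of_real (1 / fact j) *
        (\<integral>y. complex_of_real ((z \<bullet> y) ^ j) * f y \<partial>sphere_measure))"
      using int by (subst Bochner_Integration.integral_sum) (auto simp del: of_real_power)
    also have "\<dots> = 0" using ann_z by (intro sum.neutral) auto
    finally show ?thesis .
  qed
  ultimately show ?thesis by (simp add: LIMSEQ_const_iff)
qed

text \<open>
  Exponentials are used in place of polynomials because the product of \<open>exp (z \<bullet> y)\<close> and
  \<open>exp (w \<bullet> y)\<close> is again an exponential, whereas products of powers of different linear forms
  would have to be reduced to powers by polarization.
\<close>

inductive_set exponential_sums :: "('a::euclidean_space \<Rightarrow> real) set" where
  exponential: "(\<lambda>y. c * exp (z \<bullet> y)) \<in> exponential_sums"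
| add: "g \<in> exponential_sums \<Longrightarrow> h \<in> exponential_sums \<Longrightarrow> (\<lambda>y. g y + h y) \<in> exponential_sums"

lemma exponential_sums_mult:
  assumes "g \<in> exponential_sums" "h \<in> exponential_sums"
  shows "(\<lambda>y. g y * h y) \<in> exponential_sums"
  using assms(1)
proof induction
  case (exponential c z)
  show ?case using assms(2)
  proof induction
    case (exponential d w)
    show ?case using exponential_sums.exponential[of "c * d" "z + w"]
      by (simp add: inner_add_left exp_add mult_ac)
  next
    case (add g h)
    then show ?case using exponential_sums.add[OF add(3,4)] by (simp add: algebra_simps)
  qed
next
  case (add g1 g2)
  then show ?case using exponential_sums.add[OF add(3,4)] by (simp add: algebra_simps)
qed

lemma exponential_sums_continuous: "g \<in> exponential_sums \<Longrightarrow> continuous_on S g"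
  by (induction rule: exponential_sums.induct) (auto intro!: continuous_intros)

lemma exponential_sums_function_ring:
  "function_ring_on (exponential_sums :: ('a::euclidean_space \<Rightarrow> real) set) (sphere 0 1)"
proof
  fix x y :: 'a assume "x \<noteq> y"
  then obtain b where "b \<in> Basis" "x \<bullet> b \<noteq> y \<bullet> b" using euclidean_eq_iff by blast
  then show "\<exists>f\<in>exponential_sums. f x \<noteq> f y"
    using exponential_sums.exponential[of 1 b] by (intro bexI[of _ "\<lambda>y. exp (b \<bullet> y)"]) (auto simp: inner_commute)
next
  fix c show "(\<lambda>_::'a. c) \<in> exponential_sums" using exponential_sums.exponential[of c 0] by simp
qed (auto intro: exponential_sums_mult exponential_sums_continuous exponential_sums.add)

lemma continuous_annihilated:
  fixes f :: "'a::euclidean_space \<Rightarrow> complex"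
  assumes f: "integrable sphere_measure f"
    and ann: "\<And>z. (\<integral>y. complex_of_real (exp (z \<bullet> y)) * f y \<partial>sphere_measure) = 0"
    and g: "continuous_on (sphere 0 1) g"
  shows "(\<integral>y. complex_of_real (g y) * f y \<partial>sphere_measure) = 0"
proof -
  have int: "integrable sphere_measure (\<lambda>y. complex_of_real (h y) * f y)"
    if "continuous_on (sphere 0 1) h" for h
    by (intro integrable_continuous_times f continuous_intros that)
  have E: "(\<integral>y. complex_of_real (h y) * f y \<partial>sphere_measure) = 0" if "h \<in> exponential_sums" for h
    using that
  proof induction
    case (exponential c z)
    have "(\<integral>y. complex_of_real (c * exp (z \<bullet> y)) * f y \<partial>sphere_measure) =
        complex_of_real c * (\<integral>y. complex_of_real (exp (z \<bullet> y)) * f y \<partial>sphere_measure)"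
      by (subst integral_mult_right_zero[symmetric]) (simp add: mult.assoc)
    then show ?case using ann by simp
  next
    case (add g h)
    have "(\<integral>y. complex_of_real (g y + h y) * f y \<partial>sphere_measure) =
        (\<integral>y. complex_of_real (g y) * f y + complex_of_real (h y) * f y \<partial>sphere_measure)"
      by (simp add: algebra_simps)
    also have "\<dots> = 0"
      using add by (subst Bochner_Integration.integral_add) (auto intro!: int exponential_sums_continuous)
    finally show ?case .
  qed
  let ?I = "\<integral>y. norm (f y) \<partial>sphere_measure"
  have bound: "norm (\<integral>y. complex_of_real (g y) * f y \<partial>sphere_measure) \<le> \<epsilon> * ?I" if \<epsilon>: "0 < \<epsilon>" for \<epsilon>
  proof -
    obtain h where h: "h \<in> exponential_sums" "\<And>y. y \<in> sphere 0 1 \<Longrightarrow> \<bar>g y - h y\<bar> < \<epsilon>"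
      using function_ring_on.Stone_Weierstrass_basic[OF exponential_sums_function_ring g \<epsilon>] by blast
    have hc: "continuous_on (sphere 0 1) h" using h exponential_sums_continuous by blast
    have "(\<integral>y. complex_of_real (g y) * f y \<partial>sphere_measure) =
        (\<integral>y. complex_of_real (g y) * f y - complex_of_real (h y) * f y \<partial>sphere_measure)"
      using E[OF h(1)] g hc by (subst Bochner_Integration.integral_diff) (auto intro!: int)
    also have "\<dots> = (\<integral>y. complex_of_real (g y - h y) * f y \<partial>sphere_measure)"
      by (simp add: algebra_simps)
    also have "norm \<dots> \<le> (\<integral>y. \<epsilon> * norm (f y) \<partial>sphere_measure)"
      using f h(2) g hc
      by (intro Bochner_Integration.integral_norm_bound_integral int continuous_intros)
         (auto simp: space_sphere_measure norm_mult simp del: of_real_diff intro!: mult_right_mono[OF less_imp_le])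
    also have "\<dots> = \<epsilon> * ?I" by simp
    finally show ?thesis .
  qed
  have "norm (\<integral>y. complex_of_real (g y) * f y \<partial>sphere_measure) \<le> 0"
  proof (rule field_le_epsilon)
    fix \<epsilon> :: real assume \<epsilon>: "0 < \<epsilon>"
    have I: "0 \<le> ?I" by simp
    have frac: "\<epsilon> / (c + 1) * c \<le> \<epsilon>" if "0 \<le> c" for c
      using \<epsilon> that by (simp add: field_simps)
    have "norm (\<integral>y. complex_of_real (g y) * f y \<partial>sphere_measure) \<le> \<epsilon> / (?I + 1) * ?I"
      using \<epsilon> I by (intro bound divide_pos_pos add_nonneg_pos) auto
    also have "\<dots> \<le> \<epsilon>" by (rule frac[OF I])
    finally show "norm (\<integral>y. complex_of_real (g y) * f y \<partial>sphere_measure) \<le> 0 + \<epsilon>" by simp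
  qed
  then show ?thesis by simp
qed

text \<open>
  Continuous functions decrease to the indicator function of a closed set, so the integral of
  \<open>h\<close> over every closed set is \<open>0\<close>. Closed sets are stable under intersection and
  generate the Borel sets, hence the same holds for every Borel set.
\<close>

lemma AE_zero_if_continuous_annihilated_real:
  fixes h :: "'a::euclidean_space \<Rightarrow> real"
  assumes h: "integrable sphere_measure h"
    and ann: "\<And>g. continuous_on (sphere 0 1) g \<Longrightarrow> (\<integral>y. g y * h y \<partial>sphere_measure) = 0"
  shows "AE y in sphere_measure. h y = 0"
proof -
  have meas: "(\<lambda>y. indicator A y * h y) \<in> borel_measurable sphere_measure" if "A \<in> sets borel" for A :: "'a set"
  proof (intro borel_measurable_times borel_measurable_integrable[OF h])
    have "(indicator A :: 'a \<Rightarrow> real) \<in> borel_measurable (restrict_space borel (sphere 0 1))"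
      using that by (intro measurable_restrict_space1 borel_measurable_indicator)
    then show "(indicator A :: 'a \<Rightarrow> real) \<in> borel_measurable sphere_measure"
      by (simp add: measurable_cong_sets[OF sets_sphere_measure refl])
  qed
  have int: "integrable sphere_measure (\<lambda>y. indicator A y * h y)" if "A \<in> sets borel" for A :: "'a set"
    by (rule Bochner_Integration.integrable_bound[OF h meas[OF that]])
       (auto simp: indicator_def)
  have closed: "(\<integral>y. indicator C y * h y \<partial>sphere_measure) = 0" if C: "closed C" for C :: "'a set"
  proof (cases "C = {}")
    case False
    let ?g = "\<lambda>n y. max 0 (1 - real n * infdist y C)"
    have gc: "continuous_on (sphere 0 1) (?g n)" for n by (intro continuous_intros)
    have "(\<lambda>n. \<integral>y. ?g n y * h y \<partial>sphere_measure) \<longlonglongrightarrow> (\<integral>y. indicator C y * h y \<partial>sphere_measure)"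
    proof (rule integral_dominated_convergence)
      show "(\<lambda>y. indicator C y * h y) \<in> borel_measurable sphere_measure" using C meas by auto
      show "(\<lambda>y. ?g n y * h y) \<in> borel_measurable sphere_measure" for n
        by (intro borel_measurable_times borel_measurable_sphere_measure_continuous[OF gc]
            borel_measurable_integrable[OF h])
      show "integrable sphere_measure (\<lambda>y. \<bar>h y\<bar>)" using h by simp
      show "AE y in sphere_measure. norm (?g n y * h y) \<le> \<bar>h y\<bar>" for n
        by (intro AE_I2) (auto simp: abs_mult infdist_nonneg intro!: mult_left_le_one_le)
      show "AE y in sphere_measure. (\<lambda>n. ?g n y * h y) \<longlonglongrightarrow> indicator C y * h y"
      proof (intro AE_I2 tendsto_mult tendsto_const)
        fix y
        show "(\<lambda>n. ?g n y) \<longlonglongrightarrow> indicator C y"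
        proof (cases "y \<in> C")
          case False
          with C \<open>C \<noteq> {}\<close> have d: "0 < infdist y C" by (simp add: infdist_pos_not_in_closed)
          obtain m :: nat where m: "1 / infdist y C < real m" using reals_Archimedean2 by blast
          have "?g n y = 0" if "m \<le> n" for n
          proof -
            have "1 / infdist y C < real n" using m that by linarith
            then show ?thesis using d by (simp add: field_simps)
          qed
          then show ?thesis using False
            by (intro tendsto_eventually eventually_sequentiallyI[of m]) auto
        qed simp
      qed
    qed
    moreover have "(\<integral>y. ?g n y * h y \<partial>sphere_measure) = 0" for n by (rule ann[OF gc])
    ultimately show ?thesis by (simp add: LIMSEQ_const_iff)
  qed simp
  have borel: "(\<integral>y. indicator A y * h y \<partial>sphere_measure) = 0" if "A \<in> sets borel" for A :: "'a set"
  proof -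
    have "Int_stable (Collect closed :: 'a set set)" "Collect closed \<subseteq> Pow (UNIV :: 'a set)"
      "A \<in> sigma_sets UNIV (Collect closed)"
      using that by (auto simp: borel_eq_closed Int_stable_def)
    then show ?thesis
    proof (induction rule: sigma_sets_induct_disjoint)
      case (basic A)
      then show ?case using closed by auto
    next
      case (compl A)
      have "A \<in> sets borel" using compl by (simp add: borel_eq_closed)
      then have "(\<integral>y. indicator UNIV y * h y - indicator A y * h y \<partial>sphere_measure) = 0"
        using closed[of UNIV] compl int[of A] int[of UNIV]
        by (subst Bochner_Integration.integral_diff) auto
      moreover have "(\<lambda>y. indicator (UNIV - A) y * h y) = (\<lambda>y. indicator UNIV y * h y - indicator A y * h y)"
        by (auto simp: indicator_def fun_eq_iff)
      ultimately show ?case by simp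
    next
      case (union A)
      let ?A = "\<lambda>i. sphere 0 1 \<inter> A i"
      have A: "A i \<in> sets borel" for i using union(2) by (auto simp: borel_eq_closed)
      then have UA: "(\<Union>i. A i) \<in> sets borel" by auto
      have restr: "(\<integral>y. indicator B y * h y \<partial>sphere_measure) = (\<integral>y\<in>sphere 0 1 \<inter> B. h y \<partial>sphere_measure)"
        for B :: "'a set"
        unfolding set_lebesgue_integral_def
        by (intro Bochner_Integration.integral_cong) (auto simp: space_sphere_measure indicator_def)
      have "(\<integral>y\<in>(\<Union>i. ?A i). h y \<partial>sphere_measure) = (\<Sum>i. \<integral>y\<in>?A i. h y \<partial>sphere_measure)"
      proof (rule lebesgue_integral_countable_add)
        show "?A i \<in> sets sphere_measure" for i
          using A by (auto simp: sets_sphere_measure sets_restrict_space)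
        show "?A i \<inter> ?A j = {}" if "i \<noteq> j" for i j
          using union(1) that by (auto simp: disjoint_family_on_def)
        have "set_integrable sphere_measure (\<Union>i. A i) h"
          using int[OF UA] by (simp add: set_integrable_def)
        then show "set_integrable sphere_measure (\<Union>i. ?A i) h"
          unfolding set_integrable_def
          by (rule Bochner_Integration.integrable_cong[THEN iffD1, rotated 2])
             (auto simp: space_sphere_measure indicator_def)
      qed
      also have "\<dots> = 0" using union(3) by (simp add: restr)
      finally show ?case unfolding restr Int_UN_distrib .
    qed simp
  qed
  have "AE y in sphere_measure. h y = (\<lambda>_. 0) y"
  proof (rule density_unique_real)
    fix A :: "'a set" assume "A \<in> sets sphere_measure"
    then obtain B where B: "B \<in> sets borel" "A = sphere 0 1 \<inter> B"
      by (auto simp: sets_sphere_measure sets_restrict_space)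
    have "(\<integral>y\<in>A. h y \<partial>sphere_measure) = (\<integral>y. indicator (sphere 0 1 \<inter> B) y * h y \<partial>sphere_measure)"
      by (simp add: B set_lebesgue_integral_def)
    also have "\<dots> = 0" using B by (intro borel) auto
    finally show "(\<integral>y\<in>A. h y \<partial>sphere_measure) = (\<integral>y\<in>A. 0 \<partial>sphere_measure)"
      by (simp add: set_lebesgue_integral_def)
  qed (use h in auto)
  then show ?thesis by simp
qed

lemma AE_zero_if_continuous_annihilated:
  fixes f :: "'a::euclidean_space \<Rightarrow> complex"
  assumes f: "integrable sphere_measure f"
    and ann: "\<And>g. continuous_on (sphere 0 1) g \<Longrightarrow>
      (\<integral>y. complex_of_real (g y) * f y \<partial>sphere_measure) = 0"
  shows "AE y in sphere_measure. f y = 0"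
proof -
  have int: "integrable sphere_measure (\<lambda>y. complex_of_real (g y) * f y)"
    if "continuous_on (sphere 0 1) g" for g
    by (intro integrable_continuous_times f continuous_intros that)
  have "(\<integral>y. g y * Re (f y) \<partial>sphere_measure) = 0" "(\<integral>y. g y * Im (f y) \<partial>sphere_measure) = 0"
    if "continuous_on (sphere 0 1) g" for g
    using integral_Re[OF int[OF that]] integral_Im[OF int[OF that]] ann[OF that] by simp_all
  then have "AE y in sphere_measure. Re (f y) = 0" "AE y in sphere_measure. Im (f y) = 0"
    using f by (auto intro!: AE_zero_if_continuous_annihilated_real)
  then show ?thesis by eventually_elim (simp add: complex_eq_iff)
qed

text \<open>
  The dimension enters only through \<open>(DIM('a) - 2) / 2 > 0\<close>, which makes the Gegenbauer
  polynomials nondegenerate and the factor \<open>Gamma l * (k + l)\<close> of the projection positive.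
\<close>

theorem harmonic_proj_complete:
  fixes f :: "'a::euclidean_space \<Rightarrow> complex"
  assumes dim: "2 < DIM('a)" and f: "integrable sphere_measure f"
    and proj: "\<And>k x. x \<in> sphere 0 1 \<Longrightarrow> harmonic_proj k f x = 0"
  shows "AE y in sphere_measure. f y = 0"
proof -
  define l where "l = (real DIM('a) - 2) / 2"
  have l: "0 < l" using dim by (simp add: l_def)
  have "(\<integral>y. complex_of_real (gegenbauer l k (x \<bullet> y)) * f y \<partial>sphere_measure) = 0"
    if "norm x = 1" for x :: 'a and k
  proof -
    have "harmonic_proj k f x = 0" using that by (intro proj) simp
    moreover have "complex_of_real (Gamma l * (real k + l) / (2 * pi powr (l + 1))) \<noteq> 0"
    proof -
      have "0 < Gamma l * (real k + l) / (2 * pi powr (l + 1))"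
        using l Gamma_real_pos[OF l] by simp
      then show ?thesis unfolding of_real_eq_0_iff by linarith
    qed
    ultimately show ?thesis
      unfolding harmonic_proj_def Let_def l_def[symmetric] by (simp only: mult_eq_0_iff simp_thms)
  qed
  then have "(\<integral>y. complex_of_real ((x \<bullet> y) ^ m) * f y \<partial>sphere_measure) = 0"
    if "norm x = 1" for x :: 'a and m
    using powers_annihilated[OF f l] that by blast
  then have "(\<integral>y. complex_of_real (exp (z \<bullet> y)) * f y \<partial>sphere_measure) = 0" for z
    using exponentials_annihilated[OF f] by blast
  then have "(\<integral>y. complex_of_real (g y) * f y \<partial>sphere_measure) = 0"
    if "continuous_on (sphere 0 1) g" for g
    using continuous_annihilated[OF f] that by blast
  then show ?thesis
    using AE_zero_if_continuous_annihilated[OF f] by blast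
qed

section \<open>The function spaces on the sphere\<close>

lemma powr_convex_combination:
  fixes q :: real
  assumes "1 \<le> q" "0 \<le> x" "0 \<le> y" "0 < s" "0 < t" "s + t = 1"
  shows "(s * x + t * y) powr q \<le> s * x powr q + t * y powr q"
proof -
  have *: "(u * z) powr q \<le> u * z powr q" if "0 < u" "u < 1" "0 \<le> z" for u z
    using that assms(1) powr_mono'[of 1 q u] by (simp add: powr_mult mult_right_mono)
  consider "x = 0" | "y = 0" | "0 < x" "0 < y" using assms by linarith
  then show ?thesis
  proof cases
    case 1
    then show ?thesis using *[of t y] assms by simp
  next
    case 2
    then show ?thesis using *[of s x] assms by simp
  next
    case 3
    have st: "s = 1 - t" "t \<le> 1" using assms by auto
    show ?thesis
      unfolding st(1) using convex_onD[OF powr_convex[OF assms(1)], of t x y] 3 st(2) assms(5) by simp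
  qed
qed

lemma Lq_add_integrable:
  fixes f g :: "'b \<Rightarrow> complex"
  assumes "0 \<le> q" "f \<in> borel_measurable M" "g \<in> borel_measurable M"
    and "integrable M (\<lambda>x. norm (f x) powr q)" "integrable M (\<lambda>x. norm (g x) powr q)"
  shows "integrable M (\<lambda>x. norm (f x + g x) powr q)"
proof (rule Bochner_Integration.integrable_bound)
  show "integrable M (\<lambda>x. 2 powr q * (norm (f x) powr q + norm (g x) powr q))"
    using assms by simp
  show "(\<lambda>x. norm (f x + g x) powr q) \<in> borel_measurable M" using assms by measurable
  show "AE x in M. norm (norm (f x + g x) powr q) \<le>
      norm (2 powr q * (norm (f x) powr q + norm (g x) powr q))"
  proof (intro AE_I2)
    fix x
    have "norm (f x + g x) \<le> 2 * max (norm (f x)) (norm (g x))"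
      using norm_triangle_ineq[of "f x" "g x"] by linarith
    then have "norm (f x + g x) powr q \<le> (2 * max (norm (f x)) (norm (g x))) powr q"
      using assms(1) by (intro powr_mono2) auto
    also have "\<dots> = 2 powr q * max (norm (f x)) (norm (g x)) powr q"
      by (simp add: powr_mult)
    also have "\<dots> \<le> 2 powr q * (norm (f x) powr q + norm (g x) powr q)"
      by (intro mult_left_mono) (auto simp: max_def)
    finally show "norm (norm (f x + g x) powr q) \<le>
        norm (2 powr q * (norm (f x) powr q + norm (g x) powr q))" by simp
  qed
qed

lemma powr_root_le_iff:
  fixes q :: real
  assumes "0 < q" "0 \<le> I" "0 \<le> \<alpha>"
  shows "I powr (1 / q) \<le> \<alpha> \<longleftrightarrow> I \<le> \<alpha> powr q"
proof
  assume "I powr (1 / q) \<le> \<alpha>"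
  then have "(I powr (1 / q)) powr q \<le> \<alpha> powr q" using assms by (intro powr_mono2) auto
  then show "I \<le> \<alpha> powr q" using assms by (simp add: powr_powr)
next
  assume "I \<le> \<alpha> powr q"
  then have "I powr (1 / q) \<le> (\<alpha> powr q) powr (1 / q)" using assms by (intro powr_mono2) auto
  then show "I powr (1 / q) \<le> \<alpha>" using assms by (simp add: powr_powr)
qed

text \<open>
  For \<open>\<alpha> > \<parallel>f\<parallel>\<close> and \<open>\<beta> > \<parallel>g\<parallel>\<close> the normalised sum \<open>(f + g) / (\<alpha> + \<beta>)\<close> is a convex
  combination of \<open>f / \<alpha>\<close> and \<open>g / \<beta>\<close>, both in the unit ball; convexity of \<open>x powr q\<close>
  keeps it there. Taking \<open>\<alpha>\<close> and \<open>\<beta>\<close> strictly larger than the norms avoids division by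
  \<open>0\<close>.
\<close>

lemma minkowski:
  fixes f g :: "'b \<Rightarrow> complex" and q :: real
  assumes q: "1 \<le> q" and meas: "f \<in> borel_measurable M" "g \<in> borel_measurable M"
    and int: "integrable M (\<lambda>x. norm (f x) powr q)" "integrable M (\<lambda>x. norm (g x) powr q)"
  shows "(\<integral>x. norm (f x + g x) powr q \<partial>M) powr (1 / q) \<le>
    (\<integral>x. norm (f x) powr q \<partial>M) powr (1 / q) + (\<integral>x. norm (g x) powr q \<partial>M) powr (1 / q)"
    (is "?N (\<lambda>x. f x + g x) \<le> ?N f + ?N g")
proof (rule field_le_epsilon)
  fix \<epsilon> :: real assume "0 < \<epsilon>"
  define \<alpha> where "\<alpha> = ?N f + \<epsilon> / 2"
  define \<beta> where "\<beta> = ?N g + \<epsilon> / 2"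
  have pos: "0 < \<alpha>" "0 < \<beta>" using \<open>0 < \<epsilon>\<close> by (auto simp: \<alpha>_def \<beta>_def intro: add_nonneg_pos)
  have le: "(\<integral>x. norm (f x) powr q \<partial>M) \<le> \<alpha> powr q" "(\<integral>x. norm (g x) powr q \<partial>M) \<le> \<beta> powr q"
    using powr_root_le_iff[of q "\<integral>x. norm (f x) powr q \<partial>M" \<alpha>]
      powr_root_le_iff[of q "\<integral>x. norm (g x) powr q \<partial>M" \<beta>] q pos \<open>0 < \<epsilon>\<close>
    by (auto simp: \<alpha>_def \<beta>_def)
  define s where "s = \<alpha> / (\<alpha> + \<beta>)"
  define t where "t = \<beta> / (\<alpha> + \<beta>)"
  have st: "0 < s" "0 < t" "s + t = 1"
    using pos by (auto simp: s_def t_def add_divide_distrib[symmetric])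
  let ?h = "\<lambda>x. (\<alpha> + \<beta>) powr q *
    (s / \<alpha> powr q * norm (f x) powr q + t / \<beta> powr q * norm (g x) powr q)"
  have "(\<integral>x. norm (f x + g x) powr q \<partial>M) \<le> (\<integral>x. ?h x \<partial>M)"
  proof (intro integral_mono)
    show "integrable M (\<lambda>x. norm (f x + g x) powr q)"
      using q by (intro Lq_add_integrable meas int) auto
    show "integrable M ?h" using int by auto
    fix x
    have "norm (f x + g x) \<le> norm (f x) + norm (g x)" by (rule norm_triangle_ineq)
    also have "\<dots> = (\<alpha> + \<beta>) * (s * (norm (f x) / \<alpha>) + t * (norm (g x) / \<beta>))"
      using pos by (simp add: s_def t_def distrib_left)
    finally have "norm (f x + g x) powr q \<le>
        ((\<alpha> + \<beta>) * (s * (norm (f x) / \<alpha>) + t * (norm (g x) / \<beta>))) powr q"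
      using q by (intro powr_mono2) auto
    also have "\<dots> = (\<alpha> + \<beta>) powr q * (s * (norm (f x) / \<alpha>) + t * (norm (g x) / \<beta>)) powr q"
      by (rule powr_mult)
    also have "\<dots> \<le> (\<alpha> + \<beta>) powr q * (s * (norm (f x) / \<alpha>) powr q + t * (norm (g x) / \<beta>) powr q)"
      using pos st q by (intro mult_left_mono powr_convex_combination) auto
    also have "\<dots> = ?h x" using pos by (simp add: powr_divide)
    finally show "norm (f x + g x) powr q \<le> ?h x" .
  qed
  also have "\<dots> = (\<alpha> + \<beta>) powr q *
    (s / \<alpha> powr q * (\<integral>x. norm (f x) powr q \<partial>M) + t / \<beta> powr q * (\<integral>x. norm (g x) powr q \<partial>M))"
    using int by simp
  also have "\<dots> \<le> (\<alpha> + \<beta>) powr q * (s / \<alpha> powr q * \<alpha> powr q + t / \<beta> powr q * \<beta> powr q)"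
    using le st by (intro mult_left_mono add_mono) auto
  also have "\<dots> = (\<alpha> + \<beta>) powr q" using pos st by simp
  finally have "?N (\<lambda>x. f x + g x) \<le> \<alpha> + \<beta>"
    using powr_root_le_iff[of q "\<integral>x. norm (f x + g x) powr q \<partial>M" "\<alpha> + \<beta>"] q pos by simp
  then show "?N (\<lambda>x. f x + g x) \<le> ?N f + ?N g + \<epsilon>" by (simp add: \<alpha>_def \<beta>_def)
qed

lemma Cont_norm_le:
  assumes "continuous_on (sphere 0 1) f" "x \<in> sphere 0 1"
  shows "norm (f x) \<le> sp_norm Cont f"
  unfolding sp_norm.simps
proof (rule cSUP_upper[OF assms(2)])
  have "compact ((\<lambda>x. norm (f x)) ` sphere 0 1)"
    by (intro compact_continuous_image continuous_intros assms(1) compact_sphere)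
  then show "bdd_above ((\<lambda>x. norm (f x)) ` sphere 0 1)"
    by (intro bounded_imp_bdd_above compact_imp_bounded)
qed

lemma Cont_norm_least:
  fixes f :: "'a::euclidean_space \<Rightarrow> complex"
  assumes "\<And>x. x \<in> sphere 0 1 \<Longrightarrow> norm (f x) \<le> B"
  shows "sp_norm Cont f \<le> B"
  unfolding sp_norm.simps using assms by (intro cSUP_least) auto

lemma sp_carrier_add:
  assumes "valid_space X" "f \<in> sp_carrier X" "g \<in> sp_carrier X"
  shows "(\<lambda>x. f x + g x) \<in> sp_carrier X"
proof (cases X)
  case (Lq q)
  then show ?thesis using assms by (auto intro!: Lq_add_integrable)
next
  case Cont
  then show ?thesis using assms by (auto intro!: continuous_intros)
qed

lemma sp_carrier_mult:
  assumes "f \<in> sp_carrier X"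
  shows "(\<lambda>x. c * f x) \<in> sp_carrier X"
  using assms by (cases X) (auto simp: norm_mult powr_mult intro!: continuous_intros)

lemma sp_carrier_diff:
  assumes "valid_space X" "f \<in> sp_carrier X" "g \<in> sp_carrier X"
  shows "(\<lambda>x. f x - g x) \<in> sp_carrier X"
  using sp_carrier_add[OF assms(1,2) sp_carrier_mult[OF assms(3), of "-1"]] by simp

lemma sp_norm_triangle:
  assumes "valid_space X" "f \<in> sp_carrier X" "g \<in> sp_carrier X"
  shows "sp_norm X (\<lambda>x. f x + g x) \<le> sp_norm X f + sp_norm X g"
proof (cases X)
  case (Lq q)
  then show ?thesis using assms by (auto intro!: minkowski)
next
  case Cont
  show ?thesis unfolding Cont
  proof (rule Cont_norm_least)
    fix x :: 'a assume "x \<in> sphere 0 1"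
    then show "norm (f x + g x) \<le> sp_norm Cont f + sp_norm Cont g"
      using assms Cont by (intro norm_triangle_mono Cont_norm_le) auto
  qed
qed

lemma sp_norm_nonneg:
  fixes f :: "'a::euclidean_space \<Rightarrow> complex"
  assumes "f \<in> sp_carrier X"
  shows "0 \<le> sp_norm X f"
proof (cases X)
  case Cont
  obtain b :: 'a where "b \<in> Basis" using nonempty_Basis by blast
  then show ?thesis using Cont_norm_le[of f b] assms Cont
    by (auto intro: order_trans[OF norm_ge_zero])
qed simp

lemma sp_norm_mult:
  fixes f :: "'a::euclidean_space \<Rightarrow> complex"
  assumes "valid_space X" "f \<in> sp_carrier X"
  shows "sp_norm X (\<lambda>x. c * f x) = norm c * sp_norm X f"
proof (cases X)
  case (Lq q)
  then show ?thesis using assms by (simp add: norm_mult powr_mult powr_powr)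
next
  case Cont
  have le: "sp_norm Cont (\<lambda>x. c * f x) \<le> norm c * sp_norm Cont f"
    if "f \<in> sp_carrier Cont" for c and f :: "'a \<Rightarrow> complex"
    using that by (intro Cont_norm_least) (auto simp: norm_mult simp del: sp_norm.simps intro!: mult_left_mono Cont_norm_le)
  show ?thesis unfolding Cont
  proof (intro antisym le)
    show f: "f \<in> sp_carrier Cont" using assms Cont by simp
    show "norm c * sp_norm Cont f \<le> sp_norm Cont (\<lambda>x. c * f x)"
    proof (cases "c = 0")
      case True
      then show ?thesis using sp_norm_nonneg[OF sp_carrier_mult[OF f, of c]] by simp
    next
      case False
      then show ?thesis using le[OF sp_carrier_mult[OF f, of c], of "inverse c"]
        by (simp add: norm_divide field_simps del: sp_norm.simps)
    qed
  qed
qed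

lemma sp_norm_cong:
  assumes "f \<in> sp_carrier X" "g \<in> sp_carrier X" "sp_eq X f g"
  shows "sp_norm X f = sp_norm X g"
proof (cases X)
  case (Lq q)
  then have "(\<integral>x. norm (f x) powr q \<partial>sphere_measure) = (\<integral>x. norm (g x) powr q \<partial>sphere_measure)"
    using assms by (intro integral_cong_AE) auto
  then show ?thesis using Lq by simp
next
  case Cont
  then show ?thesis using assms by simp
qed

text \<open>
  This makes the projections continuous on the space. For \<open>Lq q\<close>, the inequality
  \<open>y \<le> 1 + y powr q\<close>, applied to \<open>\<bar>f\<bar> / \<alpha>\<close> with \<open>\<alpha> > \<parallel>f\<parallel>\<close>, integrates to the claim since
  the sphere has finite measure.
\<close>

lemma sp_carrier_L1:
  fixes X :: sphere_space
  assumes X: "valid_space X"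
  obtains C where "0 \<le> C" "\<And>f :: 'a::euclidean_space \<Rightarrow> complex. f \<in> sp_carrier X \<Longrightarrow>
    integrable sphere_measure f \<and> (\<integral>x. norm (f x) \<partial>sphere_measure) \<le> C * sp_norm X f"
proof (cases X)
  case (Lq q)
  interpret finite_measure "sphere_measure :: 'a measure" by (rule finite_measure_sphere_measure)
  let ?C = "measure (sphere_measure :: 'a measure) (sphere 0 1) + 1"
  have q: "1 \<le> q" using X Lq by simp
  show ?thesis
  proof (rule that[of ?C])
    fix f :: "'a \<Rightarrow> complex" assume "f \<in> sp_carrier X"
    then have f: "f \<in> borel_measurable sphere_measure" "integrable sphere_measure (\<lambda>x. norm (f x) powr q)"
      using Lq by auto
    have pt: "y \<le> 1 + y powr q" if "0 \<le> y" for y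
    proof (cases "y \<le> 1")
      case False
      then show ?thesis using powr_mono[of 1 q y] q by simp
    qed (use powr_ge_zero[of y q] in linarith)
    have int: "integrable sphere_measure f"
      using pt by (intro Bochner_Integration.integrable_bound[OF _ f(1), of "\<lambda>x. 1 + norm (f x) powr q"]) (auto simp: f(2))
    moreover have "(\<integral>x. norm (f x) \<partial>sphere_measure) \<le> ?C * \<alpha>" if \<alpha>: "sp_norm X f < \<alpha>" for \<alpha>
    proof -
      have \<alpha>0: "0 < \<alpha>" using \<alpha> Lq by (auto intro: le_less_trans[rotated])
      have I: "(\<integral>x. norm (f x) powr q \<partial>sphere_measure) \<le> \<alpha> powr q"
        using powr_root_le_iff[of q "\<integral>x. norm (f x) powr q \<partial>sphere_measure" \<alpha>] q \<alpha>0 \<alpha> Lq by simp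
      have "(\<integral>x. norm (f x) \<partial>sphere_measure) \<le>
          (\<integral>x. \<alpha> * (1 + norm (f x) powr q / \<alpha> powr q) \<partial>sphere_measure)"
      proof (intro integral_mono)
        fix x
        show "norm (f x) \<le> \<alpha> * (1 + norm (f x) powr q / \<alpha> powr q)"
          using pt[of "norm (f x) / \<alpha>"] \<alpha>0 by (simp add: powr_divide field_simps)
      qed (use int f in auto)
      also have "\<dots> = \<alpha> * (measure (sphere_measure :: 'a measure) (sphere 0 1) +
          (\<integral>x. norm (f x) powr q \<partial>sphere_measure) / \<alpha> powr q)"
        using f(2) by (simp add: space_sphere_measure)
      also have "\<dots> \<le> \<alpha> * ?C"
        using I \<alpha>0 by (intro mult_left_mono add_left_mono) auto
      finally show ?thesis by (simp add: mult.commute)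
    qed
    then have "(\<integral>x. norm (f x) \<partial>sphere_measure) / ?C \<le> \<alpha>" if "sp_norm X f < \<alpha>" for \<alpha>
      using that by (simp add: pos_divide_le_eq add_nonneg_pos mult.commute)
    then have "(\<integral>x. norm (f x) \<partial>sphere_measure) / ?C \<le> sp_norm X f"
      by (rule dense_ge)
    ultimately show "integrable sphere_measure f \<and>
        (\<integral>x. norm (f x) \<partial>sphere_measure) \<le> ?C * sp_norm X f"
      by (simp add: pos_divide_le_eq add_nonneg_pos mult.commute)
  qed simp
next
  case Cont
  interpret finite_measure "sphere_measure :: 'a measure" by (rule finite_measure_sphere_measure)
  let ?C = "measure (sphere_measure :: 'a measure) (sphere 0 1)"
  show ?thesis
  proof (rule that[of ?C])
    fix f :: "'a \<Rightarrow> complex" assume "f \<in> sp_carrier X"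
    then have f: "continuous_on (sphere 0 1) f" using Cont by simp
    have int: "integrable sphere_measure f"
      using integrable_continuous_times[of "\<lambda>_. 1" f] f by simp
    have "(\<integral>x. norm (f x) \<partial>sphere_measure) \<le> (\<integral>x. sp_norm X f \<partial>(sphere_measure :: 'a measure))"
      using int Cont_norm_le[OF f] unfolding Cont
      by (intro integral_mono) (auto simp: space_sphere_measure simp del: sp_norm.simps)
    then show "integrable sphere_measure f \<and>
        (\<integral>x. norm (f x) \<partial>sphere_measure) \<le> ?C * sp_norm X f"
      using int by (simp add: space_sphere_measure)
  qed simp
qed

lemma sp_carrier_integrable:
  assumes X: "valid_space X" and "f \<in> sp_carrier X"
  shows "integrable sphere_measure f"
  by (rule sp_carrier_L1[OF X]) (use assms(2) in blast)

text \<open>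
  If \<open>f\<close> were nonzero at a point of the sphere, the cone over the set where it is nonzero would be
  a nonempty open set, which has positive volume.
\<close>

lemma continuous_AE_zero_imp_zero:
  fixes f :: "'a::euclidean_space \<Rightarrow> complex"
  assumes f: "continuous_on (sphere 0 1) f" and AE: "AE x in sphere_measure. f x = 0"
    and x: "x \<in> sphere 0 1"
  shows "f x = 0"
proof (rule ccontr)
  assume "f x \<noteq> 0"
  define U where "U = {x. 0 < norm x \<and> norm x < 1 \<and> f (x /\<^sub>R norm x) \<noteq> 0}"
  have "open U"
  proof -
    have *: "continuous_on (ball 0 1 - {0}) (\<lambda>x. f (x /\<^sub>R norm x))"
      by (rule continuous_on_compose2[OF f]) (auto intro!: continuous_intros, metis left_inverse norm_eq_zero)
    have "open ((ball 0 1 - {0}) \<inter> (\<lambda>x. f (x /\<^sub>R norm x)) -` (- {0}))"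
      by (rule continuous_open_preimage[OF *]) auto
    also have "(ball 0 1 - {0}) \<inter> (\<lambda>x. f (x /\<^sub>R norm x)) -` (- {0}) = U"
      by (auto simp: U_def)
    finally show ?thesis .
  qed
  moreover have "(1 / 2) *\<^sub>R x \<in> U" using x \<open>f x \<noteq> 0\<close> by (auto simp: U_def)
  ultimately have "\<not> negligible U" using open_not_negligible by blast
  moreover have "negligible U"
  proof -
    define A where "A = {x \<in> sphere 0 1. f x \<noteq> 0}"
    have A: "A \<in> sets borel" "A \<subseteq> sphere 0 1"
    proof -
      have "{x \<in> space sphere_measure. f x \<noteq> 0} \<in> sets sphere_measure"
        using borel_measurable_sphere_measure_continuous[OF f] by measurable
      then show "A \<in> sets borel"
        by (auto simp: A_def space_sphere_measure sets_sphere_measure sets_restrict_space)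
    qed (auto simp: A_def)
    have "emeasure sphere_measure A = 0"
    proof (rule AE_iff_measurable[THEN iffD1, OF _ _ AE])
      show "A \<in> sets sphere_measure"
        using A by (auto simp: sets_sphere_measure sets_restrict_space)
      show "{x \<in> space sphere_measure. f x \<noteq> 0} = A" by (simp add: A_def space_sphere_measure)
    qed
    then have "emeasure lborel {x. 0 < norm x \<and> norm x < 1 \<and> x /\<^sub>R norm x \<in> A} = 0"
      unfolding emeasure_sphere_measure[OF A] by simp
    moreover have "{x. 0 < norm x \<and> norm x < 1 \<and> x /\<^sub>R norm x \<in> A} = U"
      by (auto simp: U_def A_def)
    ultimately have "U \<in> null_sets lborel" using \<open>open U\<close> by auto
    then show ?thesis using negligible_iff_null_sets null_sets_completionI by blast
  qed
  ultimately show False by simp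
qed

section \<open>The passage to harmonic coefficients\<close>

text \<open>
  Values off the sphere are irrelevant, so they are set to \<open>0\<close>; then equality of coefficient
  families is equality of functions.
\<close>

definition harmonic_coeffs :: "('a::euclidean_space \<Rightarrow> complex) \<Rightarrow> nat \<times> 'a \<Rightarrow> complex" where
  "harmonic_coeffs f = (\<lambda>(k, x). if x \<in> sphere 0 1 then harmonic_proj k f x else 0)"

lemma harmonic_coeffs_eq_iff:
  "harmonic_coeffs f = harmonic_coeffs g \<longleftrightarrow>
    (\<forall>k. \<forall>x\<in>sphere 0 1. harmonic_proj k f x = harmonic_proj k g x)"
  by (auto simp: harmonic_coeffs_def fun_eq_iff)

lemma continuous_gegenbauer_kernel:
  "continuous_on S (\<lambda>y. complex_of_real (gegenbauer l k (x \<bullet> y)))"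
  by (intro continuous_intros continuous_on_compose2[OF continuous_gegenbauer[of UNIV]]) auto

lemma harmonic_proj_linear:
  fixes f g :: "'a::euclidean_space \<Rightarrow> complex"
  assumes "integrable sphere_measure f" "integrable sphere_measure g"
  shows "harmonic_proj k (\<lambda>x. c * f x + d * g x) x = c * harmonic_proj k f x + d * harmonic_proj k g x"
proof -
  let ?P = "\<lambda>y. complex_of_real (gegenbauer ((real DIM('a) - 2) / 2) k (x \<bullet> y))"
  have int: "integrable sphere_measure (\<lambda>y. ?P y * f y)" "integrable sphere_measure (\<lambda>y. ?P y * g y)"
    by (intro integrable_continuous_times assms continuous_gegenbauer_kernel)+
  have "(\<integral>y. ?P y * (c * f y + d * g y) \<partial>sphere_measure) =
      (\<integral>y. c * (?P y * f y) + d * (?P y * g y) \<partial>sphere_measure)"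
    by (simp add: algebra_simps)
  also have "\<dots> = c * (\<integral>y. ?P y * f y \<partial>sphere_measure) + d * (\<integral>y. ?P y * g y \<partial>sphere_measure)"
    using int by simp
  finally have eq: "(\<integral>y. ?P y * (c * f y + d * g y) \<partial>sphere_measure) =
      c * (\<integral>y. ?P y * f y \<partial>sphere_measure) + d * (\<integral>y. ?P y * g y \<partial>sphere_measure)" .
  have "G * (c * u + d * v) = c * (G * u) + d * (G * v)" for G u v :: complex
    by (simp add: algebra_simps)
  then show ?thesis unfolding harmonic_proj_def Let_def eq by this
qed

lemma harmonic_proj_bounded:
  assumes "valid_space X"
  shows "\<exists>B. \<forall>f\<in>sp_carrier X. norm (harmonic_proj k f (x::'a::euclidean_space)) \<le> B * sp_norm X f"
proof -
  obtain C where C: "0 \<le> C" "\<And>f :: 'a \<Rightarrow> complex. f \<in> sp_carrier X \<Longrightarrow>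
    integrable sphere_measure f \<and> (\<integral>x. norm (f x) \<partial>sphere_measure) \<le> C * sp_norm X f"
    by (rule sp_carrier_L1[OF assms]) blast
  define l where "l = (real DIM('a) - 2) / 2"
  let ?P = "\<lambda>y. complex_of_real (gegenbauer l k (x \<bullet> y))"
  let ?G = "complex_of_real (Gamma l * (real k + l) / (2 * pi powr (l + 1)))"
  have "bounded (?P ` sphere 0 1)"
    by (intro compact_imp_bounded compact_continuous_image continuous_gegenbauer_kernel compact_sphere)
  then obtain D where D: "0 < D" "\<And>y. y \<in> sphere 0 1 \<Longrightarrow> norm (?P y) \<le> D"
    unfolding bounded_pos by blast
  have "norm (harmonic_proj k f x) \<le> (norm ?G * (D * C)) * sp_norm X f" if "f \<in> sp_carrier X" for f
  proof -
    have f: "integrable sphere_measure f" using C(2)[OF that] by blast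
    have "norm (\<integral>y. ?P y * f y \<partial>sphere_measure) \<le> (\<integral>y. D * norm (f y) \<partial>sphere_measure)"
      using f D by (intro Bochner_Integration.integral_norm_bound_integral integrable_continuous_times
          continuous_gegenbauer_kernel)
        (auto simp: norm_mult space_sphere_measure simp del: norm_of_real intro!: mult_right_mono)
    also have "\<dots> = D * (\<integral>y. norm (f y) \<partial>sphere_measure)" by simp
    also have "\<dots> \<le> D * (C * sp_norm X f)" using C(2)[OF that] D(1) by (intro mult_left_mono) auto
    finally have "norm ?G * norm (\<integral>y. ?P y * f y \<partial>sphere_measure) \<le> norm ?G * (D * (C * sp_norm X f))"
      by (rule mult_left_mono) simp
    then show ?thesis
      unfolding harmonic_proj_def Let_def l_def[symmetric] norm_mult by (simp only: mult.assoc)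
  qed
  then show ?thesis by blast
qed

lemma harmonic_coeffs_injective:
  fixes f g :: "'a::euclidean_space \<Rightarrow> complex"
  assumes dim: "2 < DIM('a)" and X: "valid_space X"
    and f: "f \<in> sp_carrier X" and g: "g \<in> sp_carrier X"
    and eq: "harmonic_coeffs f = harmonic_coeffs g"
  shows "sp_eq X f g"
proof -
  let ?d = "\<lambda>x. 1 * f x + (-1) * g x"
  note int = sp_carrier_integrable[OF X f] sp_carrier_integrable[OF X g]
  have "integrable sphere_measure ?d" using int by simp
  moreover have "harmonic_proj k ?d x = 0" if "x \<in> sphere 0 1" for k x
    unfolding harmonic_proj_linear[OF int] using eq that by (simp add: harmonic_coeffs_eq_iff)
  ultimately have AE: "AE x in sphere_measure. ?d x = 0"
    by (rule harmonic_proj_complete[OF dim])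
  show ?thesis
  proof (cases X)
    case (Lq q)
    show ?thesis unfolding Lq sp_eq.simps using AE by eventually_elim simp
  next
    case Cont
    then have "continuous_on (sphere 0 1) ?d" using f g by (auto intro!: continuous_intros)
    from continuous_AE_zero_imp_zero[OF this AE] show ?thesis using Cont by auto
  qed
qed


text \<open>
  The norm of the space carried over to coefficient families. The choice made by \<open>inv_into\<close> is
  harmless because two preimages are equal as elements of the space.
\<close>

definition coeff_norm :: "sphere_space \<Rightarrow> (nat \<times> 'a::euclidean_space \<Rightarrow> complex) \<Rightarrow> real" where
  "coeff_norm X \<phi> = sp_norm X (inv_into (sp_carrier X) harmonic_coeffs \<phi>)"

lemma coeff_norm_harmonic_coeffs:
  fixes f :: "'a::euclidean_space \<Rightarrow> complex"
  assumes "2 < DIM('a)" "valid_space X" "f \<in> sp_carrier X"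
  shows "coeff_norm X (harmonic_coeffs f) = sp_norm X f"
proof -
  let ?g = "inv_into (sp_carrier X) harmonic_coeffs (harmonic_coeffs f)"
  have g: "?g \<in> sp_carrier X" "harmonic_coeffs ?g = harmonic_coeffs f"
    using assms(3) by (auto intro: inv_into_into simp: f_inv_into_f[OF imageI])
  show ?thesis unfolding coeff_norm_def
    by (intro sp_norm_cong g(1) assms(3) harmonic_coeffs_injective[OF assms(1,2) g(1) assms(3) g(2)])
qed

lemma harmonic_coeffs_linear:
  fixes f g :: "'a::euclidean_space \<Rightarrow> complex"
  assumes X: "valid_space X" and f: "f \<in> sp_carrier X" and g: "g \<in> sp_carrier X"
  shows "harmonic_coeffs (\<lambda>x. f x + g x) = harmonic_coeffs f + harmonic_coeffs g"
    and "harmonic_coeffs (\<lambda>x. f x - g x) = harmonic_coeffs f - harmonic_coeffs g"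
    and "harmonic_coeffs (\<lambda>x. c * f x) = (\<lambda>_. c) * harmonic_coeffs f"
proof -
  note int = sp_carrier_integrable[OF X f] sp_carrier_integrable[OF X g]
  show "harmonic_coeffs (\<lambda>x. f x + g x) = harmonic_coeffs f + harmonic_coeffs g"
    using harmonic_proj_linear[OF int, of _ 1 1] by (auto simp: harmonic_coeffs_def fun_eq_iff)
  show "harmonic_coeffs (\<lambda>x. f x - g x) = harmonic_coeffs f - harmonic_coeffs g"
    using harmonic_proj_linear[OF int, of _ 1 "-1"] by (auto simp: harmonic_coeffs_def fun_eq_iff)
  show "harmonic_coeffs (\<lambda>x. c * f x) = (\<lambda>_. c) * harmonic_coeffs f"
    using harmonic_proj_linear[OF int(1) int(1), of _ c 0] by (auto simp: harmonic_coeffs_def fun_eq_iff)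
qed

lemma is_multiplier_power_value_iff:
  "is_multiplier_power_value X a r g h \<longleftrightarrow>
    h \<in> sp_carrier X \<and> harmonic_coeffs h = (\<lambda>(k, x). a k) ^ r * harmonic_coeffs g"
proof -
  have "((\<lambda>(k, x). a k) ^ r) (k, x) = a k ^ r" for k and x :: 'a
    by (induction r) auto
  then show ?thesis
    by (auto simp: is_multiplier_power_value_def harmonic_coeffs_def fun_eq_iff)
qed

text \<open>
  Projections are continuous, so they may be interchanged with the limit that defines the generator;
  the difference quotient of \<open>exp (a k * t)\<close> tends to \<open>a k\<close>.
\<close>

lemma generator_value_coeffs:
  fixes T :: "real \<Rightarrow> ('a::euclidean_space \<Rightarrow> complex) \<Rightarrow> ('a \<Rightarrow> complex)"
  assumes X: "valid_space X" and T: "\<And>t. 0 < t \<Longrightarrow> T t f \<in> sp_carrier X"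
    and mult: "exponential_multiplier X a T"
    and f: "f \<in> sp_carrier X" and h: "is_generator_value X T f h"
  shows "harmonic_coeffs h = (\<lambda>(k, x). a k) * harmonic_coeffs f"
proof -
  have hX: "h \<in> sp_carrier X" using h by (simp add: is_generator_value_def)
  have "harmonic_proj k h x = a k * harmonic_proj k f x" if x: "x \<in> sphere 0 1" for k x
  proof -
    obtain B where B: "\<And>g. g \<in> sp_carrier X \<Longrightarrow> norm (harmonic_proj k g x) \<le> B * sp_norm X g"
      using harmonic_proj_bounded[OF X, of k x] by blast
    let ?q = "\<lambda>t. (exp (a k * complex_of_real t) - 1) / complex_of_real t"
    let ?d = "\<lambda>t x. (T t f x - f x) / complex_of_real t - h x"
    have bound: "norm (?q t * harmonic_proj k f x - harmonic_proj k h x) \<le> B * sp_norm X (?d t)"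
      if t: "0 < t" for t
    proof -
      have q: "(\<lambda>x. (1 / complex_of_real t) * (T t f x - f x)) \<in> sp_carrier X"
        by (intro sp_carrier_mult sp_carrier_diff X T t f)
      have d: "?d t \<in> sp_carrier X"
        using sp_carrier_diff[OF X q hX] by simp
      have "harmonic_coeffs (?d t) =
          (\<lambda>_. 1 / complex_of_real t) * (harmonic_coeffs (T t f) - harmonic_coeffs f) - harmonic_coeffs h"
        using harmonic_coeffs_linear(2)[OF X q hX]
          harmonic_coeffs_linear(3)[OF X sp_carrier_diff[OF X T[OF t] f] hX, of "1 / complex_of_real t"]
          harmonic_coeffs_linear(2)[OF X T[OF t] f] by simp
      from fun_cong[OF this, of "(k, x)"] have "harmonic_proj k (?d t) x =
          1 / complex_of_real t * (harmonic_proj k (T t f) x - harmonic_proj k f x) - harmonic_proj k h x"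
        using x by (simp add: harmonic_coeffs_def)
      also have "harmonic_proj k (T t f) x = exp (a k * complex_of_real t) * harmonic_proj k f x"
        using mult x t f by (simp add: exponential_multiplier_def)
      finally have "harmonic_proj k (?d t) x = ?q t * harmonic_proj k f x - harmonic_proj k h x"
        by (simp add: algebra_simps diff_divide_distrib)
      then show ?thesis using B[OF d] by simp
    qed
    have "((\<lambda>t. B * sp_norm X (?d t)) \<longlongrightarrow> B * 0) (at_right 0)"
      using h unfolding is_generator_value_def by (intro tendsto_mult_left) blast
    then have lim: "((\<lambda>t. B * sp_norm X (?d t)) \<longlongrightarrow> 0) (at_right 0)" by simp
    have "((\<lambda>t. ?q t * harmonic_proj k f x - harmonic_proj k h x) \<longlongrightarrow> 0) (at_right 0)"
    proof (rule Lim_null_comparison[OF _ lim])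
      show "\<forall>\<^sub>F t in at_right 0. norm (?q t * harmonic_proj k f x - harmonic_proj k h x) \<le> B * sp_norm X (?d t)"
        using eventually_at_right_less by eventually_elim (rule bound)
    qed
    moreover have "((\<lambda>t. ?q t * harmonic_proj k f x - harmonic_proj k h x) \<longlongrightarrow>
        a k * harmonic_proj k f x - harmonic_proj k h x) (at_right 0)"
    proof (intro tendsto_intros)
      have "((\<lambda>t. exp (a k * t)) has_field_derivative a k) (at 0)"
        by (auto intro!: derivative_eq_intros)
      then have "((\<lambda>z. (exp (a k * z) - 1) / z) \<longlongrightarrow> a k) (at 0)"
        by (simp add: DERIV_def)
      moreover have "filterlim complex_of_real (at 0) (at_right 0)"
        unfolding filterlim_at by (auto intro!: tendsto_eq_intros simp: eventually_at_filter)
      ultimately show "(?q \<longlongrightarrow> a k) (at_right 0)" by (rule filterlim_compose)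
    qed
    ultimately have "a k * harmonic_proj k f x - harmonic_proj k h x = 0"
      using tendsto_unique[OF trivial_limit_at_right_real] by blast
    then show ?thesis by simp
  qed
  then show ?thesis by (auto simp: harmonic_coeffs_def fun_eq_iff)
qed

lemma exponential_multiplier_coeffs:
  assumes "exponential_multiplier X a T" "0 < t" "f \<in> sp_carrier X"
  shows "harmonic_coeffs (T t f) = (\<lambda>(k, x). exp (a k * complex_of_real t)) * harmonic_coeffs f"
  using assms by (auto simp: exponential_multiplier_def harmonic_coeffs_def fun_eq_iff)

text \<open>
  For the strong derivative of the semigroup at \<open>f\<close> the equality of the two domains is essential: it says
  that \<open>f\<close> has a generator value as soon as \<open>a k * Y_k f\<close> is the coefficient family of some element
  of the space.
\<close>

lemma smoothing_multiplier_semigroup_harmonic_coeffs: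
  fixes T :: "real \<Rightarrow> ('a::euclidean_space \<Rightarrow> complex) \<Rightarrow> ('a \<Rightarrow> complex)"
  assumes dim: "2 < DIM('a)" and X: "valid_space X"
    and T: "C0_semigroup X T" "contractive X T" "exponential_multiplier X a T"
    and smooth: "\<forall>t>0. \<forall>f\<in>sp_carrier X. T t f \<in> generator_domain X T"
    and domain: "generator_domain X T = multiplier_power_domain X a 1"
    and bound: "\<forall>t>0. \<forall>f\<in>sp_carrier X. t * sp_norm X (generator X T (T t f)) \<le> N * sp_norm X f"
  shows "smoothing_multiplier_semigroup (harmonic_coeffs ` sp_carrier X) (coeff_norm X)
    (\<lambda>c _. complex_of_real c) (\<lambda>t (k, x :: 'a). exp (a k * complex_of_real t)) (\<lambda>(k, x). a k) N"
proof -
  let ?F = "harmonic_coeffs :: ('a \<Rightarrow> complex) \<Rightarrow> nat \<times> 'a \<Rightarrow> complex"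
  let ?V = "?F ` sp_carrier X"
  let ?a = "\<lambda>(k, x :: 'a). a k"
  let ?e = "\<lambda>t (k, x :: 'a). exp (a k * complex_of_real t)"
  have TX: "T t f \<in> sp_carrier X" if "0 < t" "f \<in> sp_carrier X" for t f
    using T(1) that by (auto simp: C0_semigroup_def bounded_operator_def)
  note FT = exponential_multiplier_coeffs[OF T(3)]
  note norm_F = coeff_norm_harmonic_coeffs[OF dim X]
  have gen: "is_generator_value X T f (generator X T f)" if "f \<in> generator_domain X T" for f
  proof -
    have "\<exists>h. is_generator_value X T f h" using that by (simp add: generator_domain_def)
    then show ?thesis unfolding generator_def by (rule someI_ex)
  qed
  have gen_F: "?F (generator X T f) = ?a * ?F f" "generator X T f \<in> sp_carrier X"
    if "f \<in> generator_domain X T" for f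
  proof -
    have f: "f \<in> sp_carrier X" using that by (simp add: generator_domain_def)
    show "?F (generator X T f) = ?a * ?F f"
      using generator_value_coeffs[OF X TX[OF _ f] T(3) f gen[OF that]] .
    show "generator X T f \<in> sp_carrier X" using gen[OF that] by (simp add: is_generator_value_def)
  qed
  have smooth': "T t f \<in> generator_domain X T" if "0 < t" "f \<in> sp_carrier X" for t f
    using smooth that by blast
  have smooth_F: "?a * ?e t * ?F f = ?F (generator X T (T t f))" if "0 < t" "f \<in> sp_carrier X" for t f
    using gen_F(1)[OF smooth'[OF that]] FT[OF that] by (simp add: mult.assoc)
  show ?thesis
  proof
    show "(\<lambda>_. complex_of_real (c + d)) = (\<lambda>_. complex_of_real c) + (\<lambda>_. complex_of_real d)"
      "(\<lambda>_. complex_of_real (c * d)) = (\<lambda>_. complex_of_real c) * (\<lambda>_. complex_of_real d)" for c d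
      by (simp_all add: fun_eq_iff)
    show "(\<lambda>_. complex_of_real 1) = 1" by (simp add: fun_eq_iff)
    show "?e (s + t) = ?e s * ?e t" for s t
      by (auto simp: fun_eq_iff exp_add[symmetric] distrib_left)
    show "?e 0 = 1" by (auto simp: fun_eq_iff)
    fix \<phi> assume "\<phi> \<in> ?V"
    then obtain f where f: "f \<in> sp_carrier X" and \<phi>: "\<phi> = ?F f" by blast
    show "(\<lambda>_. complex_of_real c) * \<phi> \<in> ?V" for c
      unfolding \<phi> harmonic_coeffs_linear(3)[OF X f f, symmetric] using f by (intro imageI sp_carrier_mult)
    show "coeff_norm X ((\<lambda>_. complex_of_real c) * \<phi>) = \<bar>c\<bar> * coeff_norm X \<phi>" for c
      unfolding \<phi> harmonic_coeffs_linear(3)[OF X f f, symmetric] norm_F[OF f] norm_F[OF sp_carrier_mult[OF f]]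
      by (simp add: sp_norm_mult[OF X f])
    show "\<phi> + \<psi> \<in> ?V" "coeff_norm X (\<phi> + \<psi>) \<le> coeff_norm X \<phi> + coeff_norm X \<psi>" if "\<psi> \<in> ?V" for \<psi>
    proof -
      from that obtain g where g: "g \<in> sp_carrier X" and \<psi>: "\<psi> = ?F g" by blast
      have fg: "(\<lambda>x. f x + g x) \<in> sp_carrier X" by (rule sp_carrier_add[OF X f g])
      show "\<phi> + \<psi> \<in> ?V"
        unfolding \<phi> \<psi> harmonic_coeffs_linear(1)[OF X f g, symmetric] using fg by (rule imageI)
      show "coeff_norm X (\<phi> + \<psi>) \<le> coeff_norm X \<phi> + coeff_norm X \<psi>"
        unfolding \<phi> \<psi> harmonic_coeffs_linear(1)[OF X f g, symmetric] norm_F[OF f] norm_F[OF g] norm_F[OF fg]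
        by (rule sp_norm_triangle[OF X f g])
    qed
    show "((\<lambda>t. coeff_norm X (?e t * \<phi> - \<phi>)) \<longlongrightarrow> 0) (at_right 0)"
    proof (rule Lim_transform_eventually)
      show "((\<lambda>t. sp_norm X (T t f - f)) \<longlongrightarrow> 0) (at_right 0)"
        using T(1) f by (simp add: C0_semigroup_def)
      show "\<forall>\<^sub>F t in at_right 0. sp_norm X (T t f - f) = coeff_norm X (?e t * \<phi> - \<phi>)"
        using eventually_at_right_less
      proof eventually_elim
        fix t :: real assume t: "0 < t"
        have "?F (T t f - f) = ?e t * \<phi> - \<phi>"
          using harmonic_coeffs_linear(2)[OF X TX[OF t f] f] FT[OF t f] by (simp add: \<phi> fun_diff_def)
        then show "sp_norm X (T t f - f) = coeff_norm X (?e t * \<phi> - \<phi>)"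
          using norm_F[OF sp_carrier_diff[OF X TX[OF t f] f]] by (simp add: fun_diff_def)
      qed
    qed
    show "((\<lambda>t. coeff_norm X ((\<lambda>_. complex_of_real (1 / t)) * (?e t * \<phi> - \<phi>) - ?a * \<phi>)) \<longlongrightarrow> 0) (at_right 0)"
      if a\<phi>: "?a * \<phi> \<in> ?V"
    proof (rule Lim_transform_eventually)
      from a\<phi> obtain h where "h \<in> sp_carrier X" "?a * \<phi> = ?F h" by blast
      then have "f \<in> multiplier_power_domain X a 1"
        unfolding multiplier_power_domain_def is_multiplier_power_value_iff using f \<phi> by auto
      then have dom: "f \<in> generator_domain X T" using domain by simp
      let ?h = "generator X T f"
      show "((\<lambda>t. sp_norm X (\<lambda>x. (T t f x - f x) / complex_of_real t - ?h x)) \<longlongrightarrow> 0) (at_right 0)"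
        using gen[OF dom] by (simp add: is_generator_value_def)
      show "\<forall>\<^sub>F t in at_right 0. sp_norm X (\<lambda>x. (T t f x - f x) / complex_of_real t - ?h x) =
          coeff_norm X ((\<lambda>_. complex_of_real (1 / t)) * (?e t * \<phi> - \<phi>) - ?a * \<phi>)"
        using eventually_at_right_less
      proof eventually_elim
        fix t :: real assume t: "0 < t"
        let ?d = "\<lambda>x. T t f x - f x" and ?q = "\<lambda>x. complex_of_real (1 / t) * (T t f x - f x)"
        have d: "?d \<in> sp_carrier X" by (rule sp_carrier_diff[OF X TX[OF t f] f])
        have q: "?q \<in> sp_carrier X" by (rule sp_carrier_mult[OF d])
        have eq: "?F (\<lambda>x. ?q x - ?h x) = (\<lambda>_. complex_of_real (1 / t)) * (?e t * \<phi> - \<phi>) - ?a * \<phi>"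
          unfolding harmonic_coeffs_linear(2)[OF X q gen_F(2)[OF dom]] harmonic_coeffs_linear(3)[OF X d d]
            harmonic_coeffs_linear(2)[OF X TX[OF t f] f] FT[OF t f] gen_F(1)[OF dom] \<phi> ..
        have "(\<lambda>x. (T t f x - f x) / complex_of_real t - ?h x) = (\<lambda>x. ?q x - ?h x)" by simp
        then show "sp_norm X (\<lambda>x. (T t f x - f x) / complex_of_real t - ?h x) =
            coeff_norm X ((\<lambda>_. complex_of_real (1 / t)) * (?e t * \<phi> - \<phi>) - ?a * \<phi>)"
          unfolding eq[symmetric] norm_F[OF sp_carrier_diff[OF X q gen_F(2)[OF dom]]] by (rule arg_cong)
      qed
    qed
    fix t :: real assume t: "0 < t"
    show "?e t * \<phi> \<in> ?V"
      unfolding \<phi> FT[OF t f, symmetric] using TX[OF t f] by (rule imageI)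
    show "coeff_norm X (?e t * \<phi>) \<le> coeff_norm X \<phi>"
      unfolding \<phi> FT[OF t f, symmetric] norm_F[OF f] norm_F[OF TX[OF t f]]
      using T(2) t f by (simp add: contractive_def)
    show "?a * ?e t * \<phi> \<in> ?V"
      unfolding \<phi> smooth_F[OF t f] by (intro imageI gen_F(2) smooth' t f)
    show "t * coeff_norm X (?a * ?e t * \<phi>) \<le> N * coeff_norm X \<phi>"
      unfolding \<phi> smooth_F[OF t f] norm_F[OF f] norm_F[OF gen_F(2)[OF smooth'[OF t f]]]
      using bound t f by blast
  qed
qed

lemma boolean_sum_coeffs:
  fixes T :: "real \<Rightarrow> ('a::euclidean_space \<Rightarrow> complex) \<Rightarrow> ('a \<Rightarrow> complex)"
  assumes dim: "2 < DIM('a)" and X: "valid_space X"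
    and T: "\<And>f. f \<in> sp_carrier X \<Longrightarrow> T t f \<in> sp_carrier X"
    and mult: "exponential_multiplier X a T" and t: "0 < t" and f: "f \<in> sp_carrier X"
  shows "sp_norm X (boolean_sum r (T t) f - f) =
    coeff_norm X ((1 - (\<lambda>(k, x). exp (a k * complex_of_real t))) ^ r * harmonic_coeffs f)"
proof -
  let ?e = "\<lambda>(k, x :: 'a). exp (a k * complex_of_real t)"
  let ?D = "((\<lambda>g. g - T t g) ^^ r) f"
  have D: "?D \<in> sp_carrier X \<and> harmonic_coeffs ?D = (1 - ?e) ^ r * harmonic_coeffs f"
  proof (induction r)
    case (Suc r)
    let ?g = "((\<lambda>g. g - T t g) ^^ r) f"
    have g: "?g \<in> sp_carrier X" and F: "harmonic_coeffs ?g = (1 - ?e) ^ r * harmonic_coeffs f"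
      using Suc by blast+
    have "?g - T t ?g \<in> sp_carrier X"
      using sp_carrier_diff[OF X g T[OF g]] by (simp only: fun_diff_def)
    moreover have "harmonic_coeffs (?g - T t ?g) = harmonic_coeffs ?g - ?e * harmonic_coeffs ?g"
      using harmonic_coeffs_linear(2)[OF X g T[OF g]] exponential_multiplier_coeffs[OF mult t g]
      by (simp only: fun_diff_def)
    moreover have "\<dots> = (1 - ?e) ^ Suc r * harmonic_coeffs f"
      unfolding F by (simp only: power_Suc left_diff_distrib mult_1 mult.assoc)
    ultimately show ?case by (simp only: funpow.simps o_apply)
  qed (use f in simp)
  have "boolean_sum r (T t) f - f = (\<lambda>x. (-1) * ?D x)"
    by (simp add: boolean_sum_def fun_eq_iff)
  then have "sp_norm X (boolean_sum r (T t) f - f) = sp_norm X ?D"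
    using sp_norm_mult[OF X, of ?D "-1"] D by simp
  also have "\<dots> = coeff_norm X ((1 - ?e) ^ r * harmonic_coeffs f)"
    using coeff_norm_harmonic_coeffs[OF dim X, of ?D] D by simp
  finally show ?thesis .
qed

lemma K_functional_coeffs:
  fixes f :: "'a::euclidean_space \<Rightarrow> complex" and a :: "nat \<Rightarrow> complex"
  assumes dim: "2 < DIM('a)" and X: "valid_space X" and f: "f \<in> sp_carrier X"
  defines "A \<equiv> \<lambda>(k, x :: 'a). a k"
  shows "K_functional X a r f s =
    (INF \<psi>\<in>{\<psi> \<in> harmonic_coeffs ` sp_carrier X. A ^ r * \<psi> \<in> harmonic_coeffs ` sp_carrier X}.
      coeff_norm X (harmonic_coeffs f - \<psi>) + s * coeff_norm X (A ^ r * \<psi>))"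
proof -
  let ?F = "harmonic_coeffs :: ('a \<Rightarrow> complex) \<Rightarrow> nat \<times> 'a \<Rightarrow> complex"
  let ?V = "?F ` sp_carrier X"
  let ?D = "multiplier_power_domain X a r :: ('a \<Rightarrow> complex) set"
  have D: "g \<in> ?D \<longleftrightarrow> g \<in> sp_carrier X \<and> A ^ r * ?F g \<in> ?V" for g
    unfolding multiplier_power_domain_def is_multiplier_power_value_iff A_def by (auto intro: image_eqI[OF sym])
  have "{\<psi> \<in> ?V. A ^ r * \<psi> \<in> ?V} = ?F ` ?D" using D by auto
  moreover have "sp_norm X (f - g) + s * sp_norm X (multiplier_power X a r g) =
      coeff_norm X (?F f - ?F g) + s * coeff_norm X (A ^ r * ?F g)" if "g \<in> ?D" for g
  proof -
    have g: "g \<in> sp_carrier X" using that by (simp add: D)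
    have "is_multiplier_power_value X a r g (multiplier_power X a r g)"
    proof -
      have "\<exists>h. is_multiplier_power_value X a r g h"
        using that by (simp add: multiplier_power_domain_def)
      then show ?thesis unfolding multiplier_power_def by (rule someI_ex)
    qed
    then have h: "multiplier_power X a r g \<in> sp_carrier X"
      and Fh: "?F (multiplier_power X a r g) = A ^ r * ?F g"
      unfolding is_multiplier_power_value_iff A_def by blast+
    have "sp_norm X (f - g) = coeff_norm X (?F f - ?F g)"
      using coeff_norm_harmonic_coeffs[OF dim X sp_carrier_diff[OF X f g]]
        harmonic_coeffs_linear(2)[OF X f g] by (simp add: fun_diff_def)
    moreover have "sp_norm X (multiplier_power X a r g) = coeff_norm X (A ^ r * ?F g)"
      unfolding Fh[symmetric] by (rule coeff_norm_harmonic_coeffs[OF dim X h, symmetric])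
    ultimately show ?thesis by simp
  qed
  ultimately show ?thesis unfolding K_functional_def by (simp add: image_image)
qed

section \<open>The equivalence of Boolean sums and K-functionals\<close>

theorem theorem4p1p3:
  fixes n r :: nat
    and X :: sphere_space
    and T :: "real \<Rightarrow> ('a::euclidean_space \<Rightarrow> complex) \<Rightarrow> ('a \<Rightarrow> complex)"
    and a :: "nat \<Rightarrow> complex"
    and N :: real
  assumes "n \<ge> 2" and "DIM('a) = n + 1"
    and "valid_space X"
    and "C0_semigroup X T" and "contractive X T"
    and "exponential_multiplier X a T"
    and "\<forall>t>0. \<forall>f\<in>sp_carrier X. T t f \<in> generator_domain X T"
    and "generator_domain X T = multiplier_power_domain X a 1"
    and "\<forall>t>0. \<forall>f\<in>sp_carrier X. t * sp_norm X (generator X T (T t f)) \<le> N * sp_norm X f"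
    and "r \<ge> 1"
  shows "\<exists>C>0. \<forall>f\<in>sp_carrier X. \<forall>t>0.
           inverse C * K_functional X a r f (t ^ r) \<le> sp_norm X (boolean_sum r (T t) f - f) \<and>
           sp_norm X (boolean_sum r (T t) f - f) \<le> C * K_functional X a r f (t ^ r)"
proof -
  have dim: "2 < DIM('a)" using assms(1,2) by simp
  let ?V = "harmonic_coeffs ` sp_carrier X :: (nat \<times> 'a \<Rightarrow> complex) set"
  interpret S: smoothing_multiplier_semigroup ?V "coeff_norm X" "\<lambda>c _. complex_of_real c"
    "\<lambda>t (k, x :: 'a). exp (a k * complex_of_real t)" "\<lambda>(k, x). a k" N
    by (rule smoothing_multiplier_semigroup_harmonic_coeffs[OF dim assms(3-9)])
  let ?e = "\<lambda>t (k, x :: 'a). exp (a k * complex_of_real t)"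
  let ?B = "\<lambda>f t. sp_norm X (boolean_sum r (T t) f - f)"
  let ?K = "\<lambda>f t. K_functional X a r f (t ^ r)"
  have T: "T t f \<in> sp_carrier X" if "0 < t" "f \<in> sp_carrier X" for t f
    using assms(4) that by (auto simp: C0_semigroup_def bounded_operator_def)
  have B: "?B f t = coeff_norm X ((1 - ?e t) ^ r * harmonic_coeffs f)"
    if "0 < t" "f \<in> sp_carrier X" for f t
    by (intro boolean_sum_coeffs[OF dim assms(3) T[OF that(1)] assms(6)] that)
  have K: "?K f t = S.K r (harmonic_coeffs f) (t ^ r)" if "f \<in> sp_carrier X" for f t
    unfolding S.K_def by (rule K_functional_coeffs[OF dim assms(3) that])
  obtain C where C: "0 < C" "\<And>t f. 0 < t \<Longrightarrow> f \<in> sp_carrier X \<Longrightarrow> ?K f t \<le> C * ?B f t"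
    using S.converse_estimate[of r] B K by auto
  have direct: "?B f t \<le> 2 ^ r * ?K f t" if "0 < t" "f \<in> sp_carrier X" for f t
    using S.direct_estimate[OF that(1), of "harmonic_coeffs f" r] that by (simp add: B K)
  show ?thesis
  proof (intro exI[of _ "C + 2 ^ r"] conjI ballI allI impI)
    show "0 < C + 2 ^ r" using C(1) by (simp add: add_pos_pos)
    fix f :: "'a \<Rightarrow> complex" and t :: real
    assume f: "f \<in> sp_carrier X" and t: "0 < t"
    have V: "(1 - ?e t) ^ r * harmonic_coeffs f \<in> ?V" by (intro S.boolean_V t imageI f)
    have B0: "0 \<le> ?B f t" unfolding B[OF t f] by (rule S.nu_nonneg[OF V])
    have K0: "0 \<le> ?K f t"
      by (rule mult_left_le_imp_le[of "2 ^ r"]) (use order_trans[OF B0 direct[OF t f]] in simp_all)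
    have "?K f t \<le> (C + 2 ^ r) * ?B f t"
      using C(2)[OF t f] B0 by (simp add: distrib_right add_increasing2)
    then show "inverse (C + 2 ^ r) * ?K f t \<le> ?B f t"
      using C(1) by (simp add: field_simps add_pos_pos)
    show "?B f t \<le> (C + 2 ^ r) * ?K f t"
      using direct[OF t f] C(1) K0 by (simp add: distrib_right add_increasing)
  qed
qed

end
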